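(* Let $Z^\star\in\mathcal{S}^d$ be positive semidefinite of rank $r^\star$ with $1\le r^\star\le r$, and let $\mathcal{I}\subseteq[m]$. Suppose the linear map $\mathcal{A}:\mathcal{S}^d\to\mathbb{R}^m$ satisfies, for constants $\omega_0,\omega_1,\omega_2>0$ and all $Z\in\mathcal{S}^d$ of rank at most $2r$, $$\omega_1\|Z\|_F\le\|\mathcal{A}(Z)\|_1\le\omega_2\|Z\|_F\qquad\text{and}\qquad\omega_0\|Z\|_F\le\|\mathcal{A}_{\mathcal{I}^c}(Z)\|_1-\|\mathcal{A}_{\mathcal{I}}(Z)\|_1.$$ Let $b\in\mathbb{R}^m$ be given by $b_i=\mathcal{A}(Z^\star)_i$ for $i\in\mathcal{I}^c$ and $b_i=\eta_i$ for $i\in\mathcal{I}$, where the $\eta_i\in\mathbb{R}$ are arbitrary. Apply the LMM subgradient method with $F(X)=XX^\top$, $X\in\mathbb{R}^{d\times r}$, and $h(Z)=\|\mathcal{A}(Z)-b\|_1$, initialized at $X_0$ and with the Polyak configuration with parameters $\gamma,C_{\mathtt{lb}},C_{\mathtt{ub}}$ satisfying $$\gamma\le\min\left\{1,\frac{C_{\mathtt{lb}}}{2}\right\},\qquad C_{\mathtt{ub}}\le\frac{1}{16\sqrt{2(r-r^\star+1)}}\frac{\omega_0^2}{\omega_2^2},$$ and suppose $$\|X_0X_0^\top-Z^\star\|_F\le\frac{1}{8\sqrt2}\frac{\omega_0}{\omega_2}\lambda_{r^\star}(Z^\star).$$ Then the iterates satisfy $$\|X_kX_k^\top-Z^\star\|_F^2\le\left(1-\frac{\gamma}{8}\frac{\omega_0^2}{\omega_2^2}\right)^k\|X_0X_0^\top-Z^\star\|_F^2\quad\text{for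 all }k\ge0.$$
   Context: $\mathcal{S}^d$ is the space of symmetric $d\times d$ real matrices; matrix spaces carry the trace inner product and Frobenius norm. $\lambda_i(\cdot)$ is the $i$-th largest eigenvalue. $[m]=\{1,\dots,m\}$, $\mathcal{I}^c=[m]\setminus\mathcal{I}$, and $\mathcal{A}_{\mathcal{J}}(Z)$ is the subvector of $\mathcal{A}(Z)$ indexed by $\mathcal{J}$. LMM (Levenberg-Morrison-Marquardt) subgradient method for $f=h\circ F$, $F:\mathbf{E}\to\mathbf{Y}$. Given $x_0$, stepsizes $\gamma_k>0$ and damping coefficients $\lambda_k>0$: for $k\ge0$ pick any $v_k\in\partial h(F(x_k))$ (convex subdifferential) and set $x_{k+1}=x_k-\gamma_k(\nabla F(x_k)^\top\nabla F(x_k)+\lambda_kI)^{-1}\nabla F(x_k)^\top v_k$, where $\nabla F(x)$ is the derivative (a linear map) and $\nabla F(x)^\top$ its adjoint. Here $x_k$ is $X_k$. Write $z_k=F(x_k)$; let $h^\star$, $\mathcal{Z}^\star$ be the minimum value and set of minimizers of $h$ over $\operatorname{Im}F$, and $\Pi^x$ the orthogonal projection onto the range of $\nabla F(x)$. Polyak configuration with parameters $\gamma>0$, $0<C_{\mathtt{lb}}\le C_{\mathtt{ub}}$: $\gamma_k=\gamma\frac{h(z_k)-h^\star}{\|\Pi^{x_k}v_k\|^2}$ and $C_{\mathtt{lb}}\operatorname{dist}(z_k,\mathcal{Z}^\star)\le\lambda_k\le C_{\mathtt{ub}}\operatorname{dist}(z_k,\mathcal{Z}^\star)$ for all $k$.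 *)

theory Defs
  imports "HOL-Analysis.Analysis" "HOL-Computational_Algebra.Polynomial"
begin

section \<open>The Euclidean space of real symmetric matrices\<close>

typedef 'd symmat = "{M :: real^('d::finite)^'d. transpose M = M}"
  morphisms mat_of symmat_of
  by (rule exI[of _ "mat 1"]) simp

lemma transpose_mat_of [simp]: "transpose (mat_of M) = mat_of M"
  using mat_of by blast

lemma mat_of_symmat_of: "transpose M = M \<Longrightarrow> mat_of (symmat_of M) = M"
  by (simp add: symmat_of_inverse)

lemma transpose_eq_self_iff:
  "transpose M = M \<longleftrightarrow> (\<forall>i j. M $ i $ j = M $ j $ i)"
  by (auto simp: transpose_def vec_eq_iff)

lemma symmat_entry_sym: "mat_of A $ i $ j = mat_of A $ j $ i"
  using transpose_mat_of transpose_eq_self_iff by blast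

lemma symmat_eq_iff: "A = B \<longleftrightarrow> mat_of A = mat_of B"
  by (simp only: mat_of_inject)

instantiation symmat :: (finite) real_vector
begin

definition "0 = symmat_of 0"
definition "A + B = symmat_of (mat_of A + mat_of B)"
definition "A - B = symmat_of (mat_of A - mat_of B)"
definition "- A = symmat_of (- mat_of A)"
definition "scaleR c A = symmat_of (c *\<^sub>R mat_of A)"

lemma mat_of_zero [simp]: "mat_of 0 = 0"
  unfolding zero_symmat_def
  by (intro mat_of_symmat_of iffD2[OF transpose_eq_self_iff]) simp

lemma mat_of_add [simp]: "mat_of (A + B) = mat_of A + mat_of B"
  unfolding plus_symmat_def
  by (intro mat_of_symmat_of iffD2[OF transpose_eq_self_iff] allI)
    (metis symmat_entry_sym vector_add_component)

lemma mat_of_diff [simp]: "mat_of (A - B) = mat_of A - mat_of B"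
  unfolding minus_symmat_def
  by (intro mat_of_symmat_of iffD2[OF transpose_eq_self_iff] allI)
    (metis symmat_entry_sym vector_minus_component)

lemma mat_of_minus [simp]: "mat_of (- A) = - mat_of A"
  unfolding uminus_symmat_def
  by (intro mat_of_symmat_of iffD2[OF transpose_eq_self_iff] allI)
    (metis symmat_entry_sym vector_uminus_component)

lemma mat_of_scaleR [simp]: "mat_of (c *\<^sub>R A) = c *\<^sub>R mat_of A"
  unfolding scaleR_symmat_def
  by (intro mat_of_symmat_of iffD2[OF transpose_eq_self_iff] allI)
    (metis symmat_entry_sym vector_scaleR_component)

instance
  by standard
    (simp_all only: symmat_eq_iff mat_of_zero mat_of_add mat_of_diff mat_of_minus mat_of_scaleR
      add_ac add_0 diff_conv_add_uminus right_minus scaleR_add_right scaleR_add_left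
      scaleR_scaleR scaleR_one)

end

text \<open>The inner product of \<^typ>\<open>real^'d^'d\<close> is the trace inner product, its norm the Frobenius norm.\<close>

instantiation symmat :: (finite) real_inner
begin

definition "inner A B = inner (mat_of A) (mat_of B)"
definition "norm A = norm (mat_of A)"
definition "sgn A = A /\<^sub>R norm (A :: 'a symmat)"
definition "dist A B = norm (A - B :: 'a symmat)"
definition [code del]:
  "(uniformity :: ('a symmat \<times> 'a symmat) filter) =
     (INF e\<in>{0<..}. principal {(x, y). dist x y < e})"
definition [code del]:
  "open (U :: 'a symmat set) \<longleftrightarrow>
     (\<forall>x\<in>U. eventually (\<lambda>(x', y). x' = x \<longrightarrow> y \<in> U) uniformity)"

instance
proof
  fix A B C :: "'a symmat" and c :: real
  show "dist A B = norm (A - B)"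
    by (simp only: dist_symmat_def)
  show "sgn A = A /\<^sub>R norm A"
    by (simp only: sgn_symmat_def)
  show "(uniformity :: ('a symmat \<times> 'a symmat) filter) =
      (INF e\<in>{0<..}. principal {(x, y). dist x y < e})"
    by (rule uniformity_symmat_def)
  show "open U \<longleftrightarrow> (\<forall>x\<in>U. \<forall>\<^sub>F (x', y) in uniformity. x' = x \<longrightarrow> y \<in> U)"
    for U :: "'a symmat set"
    by (rule open_symmat_def)
  show "inner A B = inner B A"
    by (simp only: inner_symmat_def inner_commute)
  show "inner (A + B) C = inner A C + inner B C"
    by (simp add: inner_symmat_def inner_add_left)
  show "inner (c *\<^sub>R A) B = c * inner A B"
    by (simp add: inner_symmat_def)
  show "0 \<le> inner A A"
    by (simp add: inner_symmat_def)
  show "inner A A = 0 \<longleftrightarrow> A = 0"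
    by (simp add: inner_symmat_def symmat_eq_iff)
  show "norm A = sqrt (inner A A)"
    by (simp add: inner_symmat_def norm_symmat_def norm_eq_sqrt_inner)
qed

end

lemma symmat_orthonormal_basis:
  "\<exists>B :: ('d::finite) symmat set. B \<noteq> {} \<and> finite B \<and>
     (\<forall>u\<in>B. \<forall>v\<in>B. inner u v = (if u = v then 1 else 0)) \<and>
     (\<forall>x. (\<forall>u\<in>B. inner x u = 0) \<longleftrightarrow> x = 0)"
proof -
  let ?S = "{M :: real^'d^'d. transpose M = M}"
  have sub: "subspace ?S"
    by (auto simp: subspace_def transpose_def vec_eq_iff)
  obtain B where B: "B \<subseteq> ?S" "pairwise orthogonal B" "\<And>x. x \<in> B \<Longrightarrow> norm x = 1"
      "independent B" "card B = dim ?S" "span B = ?S"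
  proof (rule orthonormal_basis_subspace[OF sub], goal_cases)
    case (1 B)
    show ?case by (rule 1(1)[OF 1(2-)])
  qed
  let ?C = "mat_of -` B"
  have on: "inner u v = (if u = v then 1 else 0)" if "u \<in> B" "v \<in> B" for u v
  proof (cases "u = v")
    case True
    then show ?thesis using B(3)[OF that(1)] by (simp add: norm_eq_1)
  next
    case False
    then show ?thesis using pairwiseD[OF B(2) that False] by (simp add: orthogonal_def)
  qed
  have "inj mat_of" by (rule injI) (simp only: mat_of_inject)
  then have fin: "finite ?C"
    by (rule finite_vimageI[OF independent_imp_finite[OF B(4)]])
  have C_on: "\<forall>u\<in>?C. \<forall>v\<in>?C. inner u v = (if u = v then 1 else 0)"
  proof (intro ballI)
    fix u v assume "u \<in> ?C" "v \<in> ?C"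
    then have uv: "mat_of u \<in> B" "mat_of v \<in> B" by simp_all
    show "inner u v = (if u = v then 1 else 0)"
      unfolding inner_symmat_def on[OF uv] by (simp only: mat_of_inject)
  qed
  have zero: "(\<forall>u\<in>?C. inner x u = 0) \<longleftrightarrow> x = 0" for x
  proof
    assume x: "\<forall>u\<in>?C. inner x u = 0"
    have "orthogonal (mat_of x) y" if "y \<in> B" for y
    proof -
      have y: "mat_of (symmat_of y) = y"
        using B(1) that by (intro mat_of_symmat_of) blast
      then have "symmat_of y \<in> ?C" using that by simp
      then have "inner x (symmat_of y) = 0" using x by blast
      then show ?thesis by (simp only: inner_symmat_def y orthogonal_def)
    qed
    moreover have "mat_of x \<in> span B" unfolding B(6) by simp
    ultimately have "orthogonal (mat_of x) (mat_of x)"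
      by (rule orthogonal_to_span[rotated])
    then show "x = 0" by (simp add: orthogonal_def symmat_eq_iff)
  qed simp
  have ne: "?C \<noteq> {}"
  proof
    assume "?C = {}"
    then have "x = 0" for x :: "'d symmat" using zero[of x] by simp
    then have "symmat_of (mat 1 :: real^'d^'d) = 0" .
    then have "mat_of (symmat_of (mat 1 :: real^'d^'d)) = 0" by simp
    then have "(mat 1 :: real^'d^'d) = 0" by (simp add: mat_of_symmat_of)
    then have "(mat 1 :: real^'d^'d) $ undefined $ undefined = 0" by simp
    then show False by (simp add: mat_def)
  qed
  show ?thesis
    by (rule exI[of _ ?C], intro conjI allI) (rule ne fin C_on zero)+
qed

instantiation symmat :: (finite) euclidean_space
begin

text \<open>The class only requires some orthonormal basis; which one is irrelevant.\<close>

definition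
  "Basis = (SOME B :: 'a symmat set. B \<noteq> {} \<and> finite B \<and>
     (\<forall>u\<in>B. \<forall>v\<in>B. inner u v = (if u = v then 1 else 0)) \<and>
     (\<forall>x. (\<forall>u\<in>B. inner x u = 0) \<longleftrightarrow> x = 0))"

instance
proof -
  have *: "(Basis :: 'a symmat set) \<noteq> {} \<and> finite (Basis :: 'a symmat set) \<and>
     (\<forall>u\<in>Basis. \<forall>v\<in>Basis. inner u v = (if u = (v :: 'a symmat) then 1 else 0)) \<and>
     (\<forall>x :: 'a symmat. (\<forall>u\<in>Basis. inner x u = 0) \<longleftrightarrow> x = 0)"
    unfolding Basis_symmat_def by (rule someI_ex[OF symmat_orthonormal_basis])
  show "OFCLASS('a symmat, euclidean_space_class)"
    by standard (use * in blast)+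
qed

end

definition psd :: "('d::finite) symmat \<Rightarrow> bool" where
  "psd Z \<longleftrightarrow> (\<forall>x. 0 \<le> x \<bullet> (mat_of Z *v x))"

definition charpoly :: "real^('d::finite)^'d \<Rightarrow> real poly" where
  "charpoly M = det (\<chi> i j. (if i = j then [:0, 1:] else 0) - [:M $ i $ j:])"

text \<open>
  The \<open>i\<close>-th largest eigenvalue (counting from \<open>1\<close>, with multiplicity), for \<open>1 \<le> i \<le> CARD('d)\<close>. The
  characteristic polynomial of a symmetric matrix splits over the reals, so its real roots are all
  of its eigenvalues.
\<close>

definition eigval :: "nat \<Rightarrow> ('d::finite) symmat \<Rightarrow> real" where
  "eigval i Z = rev (sorted_list_of_multiset (proots (charpoly (mat_of Z)))) ! (i - 1)"


section \<open>The Levenberg-Morrison-Marquardt subgradient method\<close>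

definition subdifferential :: "('y::real_inner \<Rightarrow> real) \<Rightarrow> 'y \<Rightarrow> 'y set" where
  "subdifferential h z = {v. \<forall>y. h y \<ge> h z + v \<bullet> (y - z)}"

definition orth_proj :: "('y::euclidean_space) set \<Rightarrow> 'y \<Rightarrow> 'y" where
  "orth_proj S v = (THE p. p \<in> S \<and> v - p \<in> orthogonal_comp S)"

definition lmm_step ::
  "('e::euclidean_space \<Rightarrow> 'y::euclidean_space) \<Rightarrow> real \<Rightarrow> real \<Rightarrow> 'e \<Rightarrow> 'y \<Rightarrow> 'e" where
  "lmm_step F \<gamma> lam x v =
     (let D = frechet_derivative F (at x)
      in x - \<gamma> *\<^sub>R inv (\<lambda>u. adjoint D (D u) + lam *\<^sub>R u) (adjoint D v))"

definition lmm_run ::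
  "('y::euclidean_space \<Rightarrow> real) \<Rightarrow> ('e::euclidean_space \<Rightarrow> 'y) \<Rightarrow>
   (nat \<Rightarrow> real) \<Rightarrow> (nat \<Rightarrow> real) \<Rightarrow> (nat \<Rightarrow> 'e) \<Rightarrow> (nat \<Rightarrow> 'y) \<Rightarrow> bool" where
  "lmm_run h F \<gamma> lam x v \<longleftrightarrow>
     (\<forall>k. v k \<in> subdifferential h (F (x k)) \<and>
          x (Suc k) = lmm_step F (\<gamma> k) (lam k) (x k) (v k))"

definition min_value :: "('y \<Rightarrow> real) \<Rightarrow> ('e \<Rightarrow> 'y) \<Rightarrow> real" where
  "min_value h F = Inf (h ` range F)"

definition minimizers :: "('y \<Rightarrow> real) \<Rightarrow> ('e \<Rightarrow> 'y) \<Rightarrow> 'y set" where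
  "minimizers h F = {z. is_arg_min h (\<lambda>w. w \<in> range F) z}"

text \<open>
  Positivity of the stepsizes and damping coefficients is required only while the method has not
  reached a minimizer. Once \<open>F (x k)\<close> is a minimizer, the formulas give \<open>\<gamma> k = 0\<close> (also when the
  projection vanishes, as division by zero yields zero) and \<open>lam k = 0\<close>, so that
  \<^const>\<open>lmm_step\<close> leaves the iterate unchanged: a run that terminates at a solution is represented
  by the sequence that stays there.
\<close>

definition polyak_config ::
  "('y::euclidean_space \<Rightarrow> real) \<Rightarrow> ('e::euclidean_space \<Rightarrow> 'y) \<Rightarrow> real \<Rightarrow> real \<Rightarrow> real \<Rightarrow>
   (nat \<Rightarrow> real) \<Rightarrow> (nat \<Rightarrow> real) \<Rightarrow> (nat \<Rightarrow> 'e) \<Rightarrow> (nat \<Rightarrow> 'y) \<Rightarrow> bool" where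
  "polyak_config h F g Clb Cub \<gamma> lam x v \<longleftrightarrow>
     0 < g \<and> 0 < Clb \<and> Clb \<le> Cub \<and>
     (\<forall>k. (F (x k) \<notin> minimizers h F \<longrightarrow> 0 < \<gamma> k \<and> 0 < lam k) \<and>
          \<gamma> k = g * ((h (F (x k)) - min_value h F) /
            (norm (orth_proj (range (frechet_derivative F (at (x k)))) (v k)))\<^sup>2) \<and>
          Clb * infdist (F (x k)) (minimizers h F) \<le> lam k \<and>
          lam k \<le> Cub * infdist (F (x k)) (minimizers h F))"


section \<open>Low-rank matrix sensing\<close>

definition l1norm_on :: "'m set \<Rightarrow> real^('m::finite) \<Rightarrow> real" where
  "l1norm_on J y = (\<Sum>i\<in>J. \<bar>y $ i\<bar>)"

abbreviation l1norm :: "real^('m::finite) \<Rightarrow> real" where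
  "l1norm \<equiv> l1norm_on UNIV"

definition gram :: "real^('r::finite)^('d::finite) \<Rightarrow> 'd symmat" where
  "gram X = symmat_of (X ** transpose X)"

lemma mat_of_gram: "mat_of (gram X) = X ** transpose X"
  by (simp add: gram_def mat_of_symmat_of matrix_transpose_mul)

definition l1_loss :: "(('d::finite) symmat \<Rightarrow> real^('m::finite)) \<Rightarrow> real^'m \<Rightarrow> 'd symmat \<Rightarrow> real" where
  "l1_loss \<A> b Z = l1norm (\<A> Z - b)"

end

theory Submission
  imports Defs
begin

text \<open>
  Write \<open>z = X X\<^sup>T\<close>, \<open>\<delta> = z - Z\<^sup>\<star>\<close> and \<open>D U = X U\<^sup>T + U X\<^sup>T\<close> for the derivative of the Gram map at \<open>X\<close>, and let
  \<open>\<sigma>\<close> be the smallest nonzero eigenvalue of \<open>Z\<^sup>\<star>\<close>. The outlier condition makes the loss \<open>h\<close> grow at rate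
  at least \<open>\<omega>\<^sub>0\<close> away from \<open>Z\<^sup>\<star>\<close> among matrices of rank at most \<open>r\<close>, whatever the corrupted entries are, so
  \<open>Z\<^sup>\<star>\<close> is its only minimizer there; and every subgradient \<open>v\<close> satisfies \<open>v \<bullet> W \<le> \<omega>\<^sub>2 \<parallel>W\<parallel>\<close> for \<open>W\<close> of rank
  at most \<open>2r\<close>. Convergence is proved for all losses with these two properties, in
  \<open>lmm_polyak_linear_convergence\<close>.

  With stepsize \<open>t\<close> and damping \<open>l\<close>, one step moves \<open>X\<close> by \<open>-t U\<close>, where \<open>D\<^sup>*D U + l U = D\<^sup>*v\<close>, and because the Gram map is quadratic the
  error becomes exactly \<open>\<delta> - t D U + t\<^sup>2 U U\<^sup>T\<close>. The damping bounds \<open>U U\<^sup>T\<close>, and the Polyak stepsize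
  turns \<open>\<parallel>D U\<parallel> \<le> \<parallel>\<Pi> v\<parallel>\<close>, with \<open>\<Pi>\<close> the orthogonal projection onto the range of \<open>D\<close>, into a decrease of \<open>\<parallel>\<delta>\<parallel>\<^sup>2\<close>, provided that \<open>D U\<close> is well aligned with the error:
  \<open>D U \<bullet> \<delta> \<ge> 3/4 (h z - h Z\<^sup>\<star>)\<close>; this is \<open>polyak_descent\<close>.

  Alignment is the heart of the matter. Convexity gives it with \<open>v\<close> in place of \<open>D U\<close>, and the
  difference is \<open>D U \<bullet> \<delta> = v \<bullet> \<delta> - v \<bullet> Y\<close> with \<open>Y = l (D D\<^sup>* + l)\<^sup>-\<^sup>1 \<delta>\<close>. Now \<open>D D\<^sup>* W = 2 (z W + W z)\<close>, so in an
  orthonormal eigenbasis of \<open>z\<close> with eigenvalues \<open>\<mu>\<^sub>i\<close> the matrix \<open>Y\<close> has the entries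
  \<open>l / (l + 2 (\<mu>\<^sub>i + \<mu>\<^sub>j)) \<delta>\<^sub>i\<^sub>j\<close>. If \<open>\<mu>\<^sub>i\<close> or \<open>\<mu>\<^sub>j\<close> exceeds \<open>\<sigma>/4\<close>, the factor is at most \<open>2 l / \<sigma>\<close>. On the remaining block
  \<open>\<delta>\<close> is a diagonal matrix minus a block of \<open>Z\<^sup>\<star>\<close>: the former contributes entries of size at most \<open>l/4\<close>,
  at most \<open>r - r\<^sup>\<star>\<close> of them, and the latter is quadratically small in \<open>\<delta>\<close> by a perturbation argument
  (\<open>norm_small_block_le\<close>), since the eigenvalues of \<open>Z\<^sup>\<star>\<close> are either zero or at least \<open>\<sigma>\<close>. The part
  of \<open>Y\<close> in this block and the part outside it both have rank at most \<open>2r\<close>, so \<open>v \<bullet> Y\<close> is controlled by their norms; this is \<open>resolvent_split\<close>.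
\<close>

section \<open>Matrix algebra\<close>

lemma matrix_diff_ldistrib: "A ** (B - C) = A ** B - A ** C"
  for A :: "'a::ring_1^'n::finite^'m"
  by (simp add: matrix_matrix_mult_def vec_eq_iff right_diff_distrib sum_subtractf)

lemma matrix_diff_rdistrib: "(B - C) ** A = B ** A - C ** A"
  for A :: "'a::ring_1^'n^'m::finite"
  by (simp add: matrix_matrix_mult_def vec_eq_iff left_diff_distrib sum_subtractf)

lemma transpose_add: "transpose (A + B) = transpose A + transpose B"
  for A B :: "real^'n^'m"
  by (simp add: transpose_def vec_eq_iff)

lemma transpose_scaleR: "transpose (c *\<^sub>R A) = c *\<^sub>R transpose A"
  for A :: "real^'n^'m"
  by (simp add: transpose_def vec_eq_iff)

lemma matrix_add_rdistrib: "(A + B) ** C = A ** C + B ** C"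
  for A B :: "real^'n::finite^'m"
  by (simp add: matrix_matrix_mult_def vec_eq_iff distrib_right sum.distrib)

lemma matrix_mult_scaleR_left: "(c *\<^sub>R A) ** B = c *\<^sub>R (A ** B)"
  for A :: "real^'n::finite^'m"
  by (simp add: matrix_matrix_mult_def vec_eq_iff sum_distrib_left mult_ac)

lemma matrix_mult_scaleR_right: "A ** (c *\<^sub>R B) = c *\<^sub>R (A ** B)"
  for A :: "real^'n::finite^'m"
  by (simp add: matrix_matrix_mult_def vec_eq_iff sum_distrib_left mult_ac)

lemmas matrix_mult_linear_simps =
  matrix_add_ldistrib matrix_add_rdistrib transpose_add transpose_scaleR
  matrix_mult_scaleR_left matrix_mult_scaleR_right

definition diag :: "('n \<Rightarrow> real) \<Rightarrow> real^'n^'n::finite" where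
  "diag \<mu> = (\<chi> i j. if i = j then \<mu> i else 0)"

lemma diag_nth [simp]: "diag \<mu> $ i $ j = (if i = j then \<mu> i else 0)"
  by (simp add: diag_def)

lemma transpose_diag [simp]: "transpose (diag \<mu>) = diag \<mu>"
  by (auto simp: transpose_def vec_eq_iff)

lemma diag_mult_nth [simp]: "(diag \<mu> ** M) $ i $ j = \<mu> i * M $ i $ j"
  by (simp add: matrix_matrix_mult_def if_distrib[of "\<lambda>x. x * _"] cong: if_cong)

lemma mult_diag_nth [simp]: "(M ** diag \<mu>) $ i $ j = M $ i $ j * \<mu> j"
  by (simp add: matrix_matrix_mult_def if_distrib[of "\<lambda>x. _ * x"] cong: if_cong)

lemma diag_mult_vector_nth [simp]: "(diag \<mu> *v x) $ i = \<mu> i * x $ i"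
  by (simp add: matrix_vector_mult_def if_distrib[of "\<lambda>x. x * _"] cong: if_cong)

section \<open>Diagonalization of symmetric matrices\<close>

text \<open>
  A maximizer of the Rayleigh quotient on the unit sphere of an invariant subspace is an eigenvector.
\<close>

lemma symmetric_eigenvector_exists:
  fixes f :: "'a::euclidean_space \<Rightarrow> 'a"
  assumes lin: "linear f" and sym: "\<And>x y. f x \<bullet> y = x \<bullet> f y"
    and S: "subspace S" and inv: "\<And>x. x \<in> S \<Longrightarrow> f x \<in> S" and ne: "S \<noteq> {0}"
  obtains x where "x \<in> S" "norm x = 1" "f x = (x \<bullet> f x) *\<^sub>R x"
proof -
  interpret f: linear f by fact
  let ?K = "S \<inter> sphere 0 1"
  have "compact ?K"
    using closed_subspace[OF S] by (intro closed_Int_compact) auto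
  obtain y where y: "y \<in> S" "y \<noteq> 0"
    using ne subspace_0[OF S] by blast
  have "y /\<^sub>R norm y \<in> ?K"
    using y by (auto simp: subspace_scale[OF S])
  then have "?K \<noteq> {}" by blast
  have "continuous_on ?K (\<lambda>x. x \<bullet> f x)"
    using lin by (intro continuous_intros linear_continuous_on)
      (simp add: linear_conv_bounded_linear)
  then obtain x where x: "x \<in> ?K" and max: "\<And>u. u \<in> ?K \<Longrightarrow> u \<bullet> f u \<le> x \<bullet> f x"
    using continuous_attains_sup[OF \<open>compact ?K\<close> \<open>?K \<noteq> {}\<close>] by blast
  define m where "m = x \<bullet> f x"
  have xS: "x \<in> S" and x1: "norm x = 1" using x by auto
  have quad: "u \<bullet> f u \<le> m * (u \<bullet> u)" if "u \<in> S" for u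
  proof (cases "u = 0")
    case False
    have "u /\<^sub>R norm u \<in> ?K"
      using that False by (auto simp: subspace_scale[OF S])
    from max[OF this] have "(u \<bullet> f u) / (norm u)\<^sup>2 \<le> m"
      by (simp add: f.scaleR m_def power2_eq_square field_simps)
    then show ?thesis
      using False by (simp add: divide_le_eq power2_norm_eq_inner)
  qed (simp add: f.zero)
  define w where "w = f x - m *\<^sub>R x"
  have wS: "w \<in> S"
    unfolding w_def using xS by (intro subspace_diff[OF S] inv subspace_scale[OF S])
  define c where "c = w \<bullet> f w - m * (w \<bullet> w)"
  \<comment> \<open>Moving from the maximizer in the direction of the residual \<open>w\<close> would increase the quotient to first order.\<close>
  have "2 * t * (w \<bullet> w) + t\<^sup>2 * c \<le> 0" for t
  proof -
    have "x + t *\<^sub>R w \<in> S"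
      using xS wS by (intro subspace_add[OF S] subspace_scale[OF S])
    from quad[OF this] have "2 * t * (w \<bullet> (f x - m *\<^sub>R x)) + t\<^sup>2 * c \<le> 0"
      using sym[of x w] x1
      by (simp add: f.add f.scaleR inner_add inner_diff c_def inner_commute algebra_simps
          power2_eq_square m_def norm_eq_1)
    then show ?thesis by (simp add: w_def)
  qed
  \<comment> \<open>A small positive \<open>t\<close>, at which the linear term dominates the quadratic one.\<close>
  then have "2 * ((w \<bullet> w) / (\<bar>c\<bar> + 1)) * (w \<bullet> w) + ((w \<bullet> w) / (\<bar>c\<bar> + 1))\<^sup>2 * c \<le> 0" .
  moreover have "((w \<bullet> w) / (\<bar>c\<bar> + 1))\<^sup>2 * c \<ge> - ((w \<bullet> w)\<^sup>2 / (\<bar>c\<bar> + 1))"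
  proof -
    have "- c / (\<bar>c\<bar> + 1) \<le> 1"
      by (subst divide_le_eq_1_pos) auto
    then have "(w \<bullet> w)\<^sup>2 / (\<bar>c\<bar> + 1) * (- c / (\<bar>c\<bar> + 1)) \<le> (w \<bullet> w)\<^sup>2 / (\<bar>c\<bar> + 1) * 1"
      by (intro mult_left_mono) auto
    then show ?thesis by (simp add: power2_eq_square)
  qed
  ultimately have "(w \<bullet> w)\<^sup>2 / (\<bar>c\<bar> + 1) \<le> 0"
    by (simp add: power2_eq_square)
  moreover have "\<bar>c\<bar> + 1 > 0" by simp
  ultimately have "w = 0"
    by (simp add: divide_le_0_iff)
  then show ?thesis
    using that xS x1 by (simp add: w_def m_def)
qed

text \<open>
  Induction on the dimension: the orthogonal complement of an eigenvector in an invariant subspace is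
  again invariant.
\<close>

lemma symmetric_eigenbasis:
  fixes f :: "'a::euclidean_space \<Rightarrow> 'a"
  assumes lin: "linear f" and sym: "\<And>x y. f x \<bullet> y = x \<bullet> f y"
    and "subspace S" and "\<And>x. x \<in> S \<Longrightarrow> f x \<in> S"
  shows "\<exists>B\<subseteq>S. pairwise orthogonal B \<and> (\<forall>x\<in>B. norm x = 1 \<and> f x = (x \<bullet> f x) *\<^sub>R x) \<and> span B = S"
  using assms(3,4)
proof (induction "dim S" arbitrary: S rule: less_induct)
  case less
  note S = less.prems(1)
  show ?case
  proof (cases "S = {0}")
    case True
    then show ?thesis by (intro exI[of _ "{}"]) (auto simp: pairwise_def)
  next
    case False
    obtain x where x: "x \<in> S" "norm x = 1" "f x = (x \<bullet> f x) *\<^sub>R x"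
      using symmetric_eigenvector_exists[OF lin sym less.prems False] by blast
    have xx: "x \<bullet> x = 1" using x(2) by (simp add: norm_eq_1)
    define S' where "S' = S \<inter> {y. x \<bullet> y = 0}"
    have S': "subspace S'"
      unfolding S'_def using subspace_inter[OF S subspace_hyperplane] .
    have inv': "f y \<in> S'" if "y \<in> S'" for y
    proof -
      have "x \<bullet> f y = (x \<bullet> f x) * (x \<bullet> y)"
        using sym[of x y] x(3) by (metis inner_scaleR_left)
      then show ?thesis using that less.prems(2) by (simp add: S'_def)
    qed
    have "x \<notin> S'" using xx by (simp add: S'_def)
    then have "S' \<subset> S" using x(1) unfolding S'_def by blast
    then have "dim S' < dim S"
      using dim_psubset[of S' S] S S' by (simp add: span_eq_iff[THEN iffD2])
    from less.hyps[OF this S' inv'] obtain B where B: "B \<subseteq> S'" "pairwise orthogonal B"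
      "\<forall>x\<in>B. norm x = 1 \<and> f x = (x \<bullet> f x) *\<^sub>R x" "span B = S'" by blast
    have "pairwise orthogonal (insert x B)"
      using B(1,2) by (auto simp: pairwise_insert S'_def orthogonal_def inner_commute)
    moreover have "span (insert x B) = S"
    proof
      show "span (insert x B) \<subseteq> S"
        using x(1) B(1) by (intro span_minimal S) (auto simp: S'_def)
      show "S \<subseteq> span (insert x B)"
      proof
        fix y assume "y \<in> S"
        then have "y - (x \<bullet> y) *\<^sub>R x \<in> S'"
          using x(1) xx by (simp add: S'_def inner_diff subspace_diff[OF S] subspace_scale[OF S])
        then show "y \<in> span (insert x B)"
          using B(4) by (auto simp: span_insert)
      qed
    qed
    ultimately show ?thesis
      using B x by (intro exI[of _ "insert x B"]) (auto simp: S'_def)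
  qed
qed

lemma symmetric_matrix_diagonalization:
  fixes A :: "real^'n::finite^'n"
  assumes "transpose A = A"
  obtains E \<mu> where "orthogonal_matrix E" "A = E ** diag \<mu> ** transpose E"
proof -
  have sym: "(A *v x) \<bullet> y = x \<bullet> (A *v y)" for x y
    by (metis assms dot_lmul_matrix inner_commute transpose_matrix_vector)
  obtain B where B: "pairwise orthogonal B" "\<And>x. x \<in> B \<Longrightarrow> norm x = 1"
      "\<And>x. x \<in> B \<Longrightarrow> A *v x = (x \<bullet> (A *v x)) *\<^sub>R x" "span B = UNIV"
    using symmetric_eigenbasis[of "\<lambda>x. A *v x", OF matrix_vector_mul_linear sym subspace_UNIV] by auto
  have ind: "independent B"
    using B(1,2) by (intro pairwise_orthogonal_independent) force+
  then have fin: "finite B" by (rule independent_imp_finite)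
  have "card B = CARD('n)"
    using dim_eq_card[of B "UNIV :: (real^'n) set"] ind B(4) by (simp add: span_UNIV)
  then obtain e :: "'n \<Rightarrow> real^'n" where e: "bij_betw e UNIV B"
    using fin finite_same_card_bij[of "UNIV :: 'n set" B] by auto
  define E :: "real^'n^'n" where "E = (\<chi> i j. e j $ i)"
  have col: "column j E = e j" for j by (simp add: E_def column_def vec_eq_iff)
  have orth: "orthogonal_matrix E"
    unfolding orthogonal_matrix_orthonormal_columns col
    using B(1,2) e unfolding bij_betw_def pairwise_def inj_on_def by blast
  define \<mu> where "\<mu> j = e j \<bullet> (A *v e j)" for j
  have "A ** E = E ** diag \<mu>"
  proof -
    have "(A ** E) $ i $ j = (E ** diag \<mu>) $ i $ j" for i j
    proof -
      have "A *v e j = \<mu> j *\<^sub>R e j"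
        using B(3)[of "e j"] e by (auto simp: \<mu>_def bij_betw_def)
      then have "(A *v e j) $ i = \<mu> j * e j $ i" by simp
      then show ?thesis
        by (simp add: matrix_vector_mult_def matrix_matrix_mult_def[of A] E_def)
    qed
    then show ?thesis by (simp add: vec_eq_iff)
  qed
  then have "A = E ** diag \<mu> ** transpose E"
    using orth by (metis matrix_mul_assoc matrix_mul_rid orthogonal_matrix_def)
  then show ?thesis using orth that by blast
qed

section \<open>Rank\<close>

lemma rank_diagonalized:
  fixes E :: "real^'n::finite^'n"
  assumes E: "orthogonal_matrix E"
  shows "rank (E ** M ** transpose E) = rank M"
proof (rule antisym)
  show "rank (E ** M ** transpose E) \<le> rank M"
    by (metis order_trans rank_mul_le_left rank_mul_le_right)
  have "M = transpose E ** (E ** M ** transpose E) ** E"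
    using E by (metis matrix_mul_assoc matrix_mul_lid matrix_mul_rid orthogonal_matrix_def)
  then show "rank M \<le> rank (E ** M ** transpose E)"
    by (metis order_trans rank_mul_le_left rank_mul_le_right)
qed

lemma dim_coordinate_subspace: "dim {x :: real^'n::finite. \<forall>i. i \<notin> S \<longrightarrow> x $ i = 0} = card S"
  using dim_substandard_cart[where 'a=real and d=S] by (simp only: dim_vec_eq)

lemma rank_le_card_rows:
  fixes M :: "real^'n::finite^'m::finite"
  assumes "\<And>i j. i \<notin> S \<Longrightarrow> M $ i $ j = 0"
  shows "rank M \<le> card S"
proof -
  have "range ((*v) M) \<subseteq> {x. \<forall>i. i \<notin> S \<longrightarrow> x $ i = 0}"
    using assms by (auto simp: matrix_vector_mult_def)
  from dim_subset[OF this] show ?thesis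
    by (simp only: rank_dim_range dim_coordinate_subspace)
qed

lemma rank_add_le:
  fixes A B :: "real^'n::finite^'m::finite"
  shows "rank (A + B) \<le> rank A + rank B"
proof -
  have "range ((*v) (A + B)) \<subseteq> {x + y |x y. x \<in> range ((*v) A) \<and> y \<in> range ((*v) B)}"
    by (auto simp: matrix_vector_mult_add_rdistrib)
  then have "rank (A + B) \<le> dim {x + y |x y. x \<in> range ((*v) A) \<and> y \<in> range ((*v) B)}"
    unfolding rank_dim_range by (rule dim_subset)
  also have "\<dots> \<le> rank A + rank B"
    using dim_sums_Int[of "range ((*v) A)" "range ((*v) B)"]
    by (simp add: rank_dim_range linear_subspace_image)
  finally show ?thesis .
qed

lemma rank_minus: "rank (- A) = rank A"
  for A :: "real^'n::finite^'m::finite"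
proof -
  have "(- A) *v x = A *v (- x)" for x
    by (simp add: matrix_vector_mult_def vec_eq_iff)
  then have "range ((*v) (- A)) = (*v) A ` range uminus"
    unfolding image_image by (intro image_cong refl)
  also have "range uminus = (UNIV :: (real^'n) set)" by (rule surj_uminus)
  finally show ?thesis by (simp add: rank_dim_range)
qed

lemma rank_diag:
  fixes \<mu> :: "'n::finite \<Rightarrow> real"
  shows "rank (diag \<mu>) = card {i. \<mu> i \<noteq> 0}"
proof -
  have "range ((*v) (diag \<mu>)) = {x. \<forall>i. i \<notin> {i. \<mu> i \<noteq> 0} \<longrightarrow> x $ i = 0}" (is "_ = ?S")
  proof
    show "?S \<subseteq> range ((*v) (diag \<mu>))"
    proof
      fix x assume "x \<in> ?S"
      then have "x = diag \<mu> *v (\<chi> i. x $ i / \<mu> i)"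
        by (auto simp: vec_eq_iff)
      then show "x \<in> range ((*v) (diag \<mu>))" by blast
    qed
  qed auto
  then show ?thesis
    by (simp only: rank_dim_range dim_coordinate_subspace)
qed

lemma rank_le_rows_cols:
  fixes M :: "real^'n::finite^'n"
  assumes "\<And>i j. i \<notin> S \<Longrightarrow> j \<notin> S \<Longrightarrow> M $ i $ j = 0"
  shows "rank M \<le> 2 * card S"
proof -
  define R where "R = (\<chi> i j. if i \<in> S then M $ i $ j else 0)"
  define C where "C = (\<chi> i j. if i \<in> S then 0 else M $ i $ j)"
  have "M = R + C" by (auto simp: R_def C_def vec_eq_iff)
  moreover have "rank R \<le> card S"
    by (rule rank_le_card_rows) (simp add: R_def)
  moreover have "rank (transpose C) \<le> card S"
    using assms by (intro rank_le_card_rows) (auto simp: C_def transpose_def)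
  ultimately show ?thesis
    using rank_add_le[of R C] by (simp add: rank_transpose)
qed

section \<open>Eigenvalues and the characteristic polynomial\<close>

lemma charpoly_diagonalized:
  fixes E :: "real^'n::finite^'n"
  assumes E: "orthogonal_matrix E" and A: "A = E ** diag \<mu> ** transpose E"
  shows "charpoly A = (\<Prod>i\<in>UNIV. [:- \<mu> i, 1:])"
proof -
  \<comment> \<open>The embedding of real matrices as constant polynomial matrices is multiplicative, so the similarity survives it.\<close>
  define c :: "real^'n^'n \<Rightarrow> real poly^'n^'n" where "c M = (\<chi> i j. [:M $ i $ j:])" for M
  have c_mult: "c (M ** N) = c M ** c N" for M N
    by (simp add: c_def matrix_matrix_mult_def vec_eq_iff poly_eq_iff coeff_sum
        coeff_pCons mult.commute split: nat.splits)
  have c_one: "c (mat 1) = mat 1"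
    by (auto simp: c_def mat_def vec_eq_iff one_pCons)
  let ?L = "\<lambda>M. (\<chi> i j. (if i = j then [:0, 1:] else 0) - [:M $ i $ j:]) :: real poly^'n^'n"
  have L: "?L M = mat [:0,1:] - c M" for M
    by (simp add: c_def mat_def vec_eq_iff)
  have EE: "c E ** c (transpose E) = mat 1" "E ** transpose E = mat 1"
    using E c_mult c_one by (metis orthogonal_matrix_def)+
  have scal: "c E ** mat [:0,1:] = mat [:0,1:] ** c E"
    by (simp add: matrix_matrix_mult_def mat_def vec_eq_iff if_distrib[of "\<lambda>x. x * _"]
        if_distrib[of "\<lambda>x. _ * x"] mult.commute cong: if_cong)
  have "?L A = c E ** ?L (diag \<mu>) ** c (transpose E)"
    unfolding L A c_mult
    by (simp add: matrix_diff_ldistrib matrix_diff_rdistrib scal)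
       (metis EE(1) matrix_mul_assoc matrix_mul_rid)
  then have "charpoly A = det (?L (diag \<mu>)) * (det (c E) * det (c (transpose E)))"
    by (simp add: charpoly_def det_mul)
  also have "det (c E) * det (c (transpose E)) = 1"
    using arg_cong[OF EE(1), of det] by (simp add: det_mul)
  also have "det (?L (diag \<mu>)) = (\<Prod>i\<in>UNIV. [:- \<mu> i, 1:])"
    by (subst det_diagonal) auto
  finally show ?thesis by simp
qed

lemma proots_charpoly_diagonalized:
  fixes E :: "real^'n::finite^'n"
  assumes "orthogonal_matrix E" and "A = E ** diag \<mu> ** transpose E"
  shows "proots (charpoly A) = image_mset \<mu> (mset_set UNIV)"
proof -
  have "proots (charpoly A) = (\<Sum>i\<in>UNIV. {#\<mu> i#})"
    unfolding charpoly_diagonalized[OF assms] by (subst proots_prod) auto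
  also have "\<dots> = image_mset \<mu> (mset_set UNIV)"
    by (simp add: sum_unfold_sum_mset)
  finally show ?thesis .
qed

text \<open>
  If exactly \<open>n\<close> members of a multiset are positive, they fill the first \<open>n\<close> places of its descending
  enumeration. This identifies \<^const>\<open>eigval\<close> at the rank of a positive
  semidefinite matrix as its smallest nonzero eigenvalue.
\<close>

lemma nth_rev_sorted_list_of_multiset_pos:
  fixes M :: "real multiset"
  assumes card: "size (filter_mset (\<lambda>x. 0 < x) M) = n" and n: "1 \<le> n"
  defines "L \<equiv> rev (sorted_list_of_multiset M)"
  shows "0 < L ! (n - 1)" and "\<And>x. x \<in># M \<Longrightarrow> 0 < x \<Longrightarrow> L ! (n - 1) \<le> x"
proof -
  have desc: "sorted_wrt (\<ge>) L"
    by (simp add: L_def sorted_wrt_rev)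
  have M: "mset L = M" by (simp add: L_def)
  have "length (filter (\<lambda>x. 0 < x) L) = n"
    using card M by (metis mset_filter size_mset)
  then have count: "card {i. i < length L \<and> 0 < L ! i} = n"
    by (simp add: length_filter_conv_card)
  then have len: "n \<le> length L"
    using card_mono[of "{..<length L}" "{i. i < length L \<and> 0 < L ! i}"] by auto
  have mono: "L ! j \<le> L ! i" if "i \<le> j" "j < length L" for i j
    using that desc by (cases "i = j") (auto simp: sorted_wrt_iff_nth_less)
  show pos: "0 < L ! (n - 1)"
  proof (rule ccontr)
    assume "\<not> 0 < L ! (n - 1)"
    then have "i < n - 1" if "i < length L" "0 < L ! i" for i
      using that mono[of "n - 1" i] by linarith
    then have "{i. i < length L \<and> 0 < L ! i} \<subseteq> {..<n - 1}" by blast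
    from card_mono[OF _ this] count n show False by simp
  qed
  fix x assume "x \<in># M" "0 < x"
  then obtain j where j: "j < length L" "L ! j = x"
    using M by (metis in_set_conv_nth set_mset_mset)
  show "L ! (n - 1) \<le> x"
  proof (rule ccontr)
    assume "\<not> L ! (n - 1) \<le> x"
    have "n - 1 < length L" using len n by simp
    have "n - 1 < j"
      using mono[of j "n - 1"] \<open>\<not> L ! (n - 1) \<le> x\<close> \<open>n - 1 < length L\<close> j(2) by (force simp: not_less)
    have "i < length L \<and> 0 < L ! i" if "i < n" for i
      using mono[of i "n - 1"] pos that len \<open>n - 1 < length L\<close> by force
    then have "{..<n} \<union> {j} \<subseteq> {i. i < length L \<and> 0 < L ! i}"
      using j \<open>0 < x\<close> by auto
    from card_mono[OF _ this] count \<open>n - 1 < j\<close> show False by simp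
  qed
qed

lemma eigval_diagonalized:
  fixes E :: "real^'n::finite^'n"
  assumes E: "orthogonal_matrix E" and A: "mat_of A = E ** diag \<mu> ** transpose E"
    and nonneg: "\<And>i. 0 \<le> \<mu> i" and n: "rank (mat_of A) = n" "1 \<le> n"
  shows "0 < eigval n A" and "\<mu> i \<noteq> 0 \<Longrightarrow> eigval n A \<le> \<mu> i"
proof -
  note M = proots_charpoly_diagonalized[OF E A]
  have "{i. \<mu> i \<noteq> 0} = {i. 0 < \<mu> i}"
    using nonneg by (auto simp: less_le)
  then have "size (filter_mset (\<lambda>x. 0 < x) (proots (charpoly (mat_of A)))) = n"
    using n(1) rank_diagonalized[OF E, of "diag \<mu>"] unfolding M
    by (simp add: A rank_diag filter_mset_image_mset)
  note * = nth_rev_sorted_list_of_multiset_pos[OF this n(2)]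
  show "0 < eigval n A" using *(1) by (simp add: eigval_def)
  show "eigval n A \<le> \<mu> i" if "\<mu> i \<noteq> 0"
    using *(2)[of "\<mu> i"] that nonneg[of i] by (simp add: eigval_def M less_le)
qed

lemma psd_eigenvalues_nonneg:
  fixes E :: "real^'n::finite^'n"
  assumes E: "orthogonal_matrix E" and A: "mat_of A = E ** diag \<mu> ** transpose E"
    and "psd A"
  shows "0 \<le> \<mu> i"
proof -
  let ?x = "E *v axis i 1"
  have "transpose E *v ?x = axis i 1"
    using E by (simp add: matrix_vector_mul_assoc orthogonal_matrix_def)
  then have "mat_of A *v ?x = E *v (diag \<mu> *v axis i 1)"
    unfolding A by (metis matrix_vector_mul_assoc)
  also have "diag \<mu> *v axis i 1 = \<mu> i *\<^sub>R axis i 1"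
    by (simp add: vec_eq_iff axis_def)
  finally have "?x \<bullet> (mat_of A *v ?x) = \<mu> i * (?x \<bullet> ?x)"
    by (simp add: matrix_vector_mult_scaleR)
  also have "?x \<bullet> ?x = 1"
    by (metis \<open>transpose E *v ?x = axis i 1\<close> dot_lmul_matrix inner_axis_axis inner_real_def mult_1 transpose_matrix_vector)
  finally show ?thesis using \<open>psd A\<close> by (metis psd_def mult.right_neutral)
qed

section \<open>The Frobenius inner product\<close>

lemma frobenius_inner: "A \<bullet> B = (\<Sum>i\<in>UNIV. \<Sum>j\<in>UNIV. A $ i $ j * B $ i $ j)"
  for A B :: "real^'n::finite^'m::finite"
  by (simp add: inner_vec_def)

lemma frobenius_norm_power2: "(norm A)\<^sup>2 = (\<Sum>i\<in>UNIV. \<Sum>j\<in>UNIV. (A $ i $ j)\<^sup>2)"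
  for A :: "real^'n::finite^'m::finite"
  unfolding power2_norm_eq_inner frobenius_inner by (simp add: power2_eq_square)

lemma inner_transpose: "transpose A \<bullet> transpose B = A \<bullet> B"
  for A B :: "real^'n::finite^'m::finite"
  unfolding frobenius_inner transpose_def by (subst sum.swap) simp

lemma inner_matrix_mult_left: "(A ** B) \<bullet> C = B \<bullet> (transpose A ** C)"
  for A :: "real^'n::finite^'m::finite" and B :: "real^'k::finite^'n"
proof -
  have "(A ** B) \<bullet> C = (\<Sum>i\<in>UNIV. \<Sum>j\<in>UNIV. \<Sum>k\<in>UNIV. A $ i $ k * B $ k $ j * C $ i $ j)"
    by (simp add: frobenius_inner matrix_matrix_mult_def sum_distrib_right)
  also have "\<dots> = (\<Sum>i\<in>UNIV. \<Sum>k\<in>UNIV. \<Sum>j\<in>UNIV. A $ i $ k * B $ k $ j * C $ i $ j)"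
    by (intro sum.cong refl sum.swap)
  also have "\<dots> = (\<Sum>k\<in>UNIV. \<Sum>i\<in>UNIV. \<Sum>j\<in>UNIV. A $ i $ k * B $ k $ j * C $ i $ j)"
    by (rule sum.swap)
  also have "\<dots> = (\<Sum>k\<in>UNIV. \<Sum>j\<in>UNIV. \<Sum>i\<in>UNIV. A $ i $ k * B $ k $ j * C $ i $ j)"
    by (intro sum.cong refl sum.swap)
  also have "\<dots> = B \<bullet> (transpose A ** C)"
    by (simp add: frobenius_inner matrix_matrix_mult_def transpose_def sum_distrib_left mult_ac)
  finally show ?thesis .
qed

lemma inner_matrix_mult_right: "(A ** B) \<bullet> C = A \<bullet> (C ** transpose B)"
  for A :: "real^'n::finite^'m::finite" and B :: "real^'k::finite^'n"
proof -
  have "(A ** B) \<bullet> C = (transpose B ** transpose A) \<bullet> transpose C"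
    unfolding matrix_transpose_mul[symmetric] inner_transpose ..
  also have "\<dots> = A \<bullet> (C ** transpose B)"
    unfolding inner_matrix_mult_left transpose_transpose
    using inner_transpose[of A "C ** transpose B"] by (simp add: matrix_transpose_mul)
  finally show ?thesis .
qed

lemma norm_orthogonal_mult_left:
  fixes A :: "real^'k::finite^'n::finite"
  assumes "orthogonal_matrix E"
  shows "norm (E ** A) = norm A"
proof -
  have "(E ** A) \<bullet> (E ** A) = A \<bullet> ((transpose E ** E) ** A)"
    unfolding inner_matrix_mult_left matrix_mul_assoc ..
  then show ?thesis using assms by (simp add: norm_eq orthogonal_matrix_def)
qed

lemma norm_orthogonal_mult_right:
  fixes A :: "real^'n::finite^'k::finite"
  assumes "orthogonal_matrix E"
  shows "norm (A ** E) = norm A"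
proof -
  have "(A ** E) \<bullet> (A ** E) = A \<bullet> (A ** (E ** transpose E))"
    unfolding inner_matrix_mult_right matrix_mul_assoc ..
  then show ?thesis using assms by (simp add: norm_eq orthogonal_matrix_def)
qed

lemma norm_orthogonal_mult_vector:
  fixes E :: "real^'n::finite^'n"
  assumes "orthogonal_matrix E"
  shows "norm (E *v x) = norm x"
proof -
  have "(E *v x) \<bullet> (E *v x) = x \<bullet> ((transpose E ** E) *v x)"
    by (metis dot_lmul_matrix inner_commute matrix_vector_mul_assoc transpose_matrix_vector)
  then show ?thesis using assms by (simp add: norm_eq orthogonal_matrix_def)
qed

lemma frobenius_norm_le_entrywise:
  fixes A B :: "real^'n::finite^'m::finite"
  assumes "0 \<le> c" and "\<And>i j. \<bar>A $ i $ j\<bar> \<le> c * \<bar>B $ i $ j\<bar>"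
  shows "norm A \<le> c * norm B"
proof -
  have "(norm A)\<^sup>2 \<le> (\<Sum>i\<in>UNIV. \<Sum>j\<in>UNIV. (c * \<bar>B $ i $ j\<bar>)\<^sup>2)"
    unfolding frobenius_norm_power2
    by (intro sum_mono) (metis assms(2) abs_ge_zero power2_abs power_mono)
  also have "\<dots> = (c * norm B)\<^sup>2"
    by (simp add: power_mult_distrib frobenius_norm_power2 sum_distrib_left)
  finally show ?thesis
    by (rule power2_le_imp_le) (simp add: assms(1))
qed

lemma norm_matrix_mult_transpose_le: "norm (A ** transpose B) \<le> norm A * norm B"
  for A :: "real^'n::finite^'m::finite" and B :: "real^'n^'k::finite"
proof -
  have "(norm (A ** transpose B))\<^sup>2 = (\<Sum>i\<in>UNIV. \<Sum>j\<in>UNIV. (A $ i \<bullet> B $ j)\<^sup>2)"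
    by (simp add: frobenius_norm_power2 matrix_matrix_mult_def transpose_def inner_vec_def)
  also have "\<dots> \<le> (\<Sum>i\<in>UNIV. \<Sum>j\<in>UNIV. (norm (A $ i))\<^sup>2 * (norm (B $ j))\<^sup>2)"
    by (intro sum_mono) (metis Cauchy_Schwarz_ineq power2_norm_eq_inner)
  also have "\<dots> = (norm A * norm B)\<^sup>2"
    by (simp add: power_mult_distrib norm_vec_def L2_set_def sum_nonneg sum_product)
  finally show ?thesis
    by (rule power2_le_imp_le) simp
qed

lemma norm_matrix_vector_mult_le: "norm (A *v x) \<le> norm A * norm x"
  for A :: "real^'n::finite^'m::finite"
proof -
  have "(norm (A *v x))\<^sup>2 = (\<Sum>i\<in>UNIV. (A $ i \<bullet> x)\<^sup>2)"
    by (simp add: norm_vec_def L2_set_def sum_nonneg matrix_mult_dot)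
  also have "\<dots> \<le> (\<Sum>i\<in>UNIV. (norm (A $ i))\<^sup>2 * (norm x)\<^sup>2)"
    by (intro sum_mono) (metis Cauchy_Schwarz_ineq power2_norm_eq_inner)
  also have "\<dots> = (norm A * norm x)\<^sup>2"
    by (simp add: power_mult_distrib norm_vec_def[of A] L2_set_def sum_nonneg sum_distrib_right)
  finally show ?thesis
    by (rule power2_le_imp_le) simp
qed

section \<open>Perturbation of a spectrum with a gap\<close>

text \<open>
  In these two lemmas \<open>diag \<mu>\<close> is a perturbation of \<open>C (diag \<nu>) C\<^sup>T\<close>, whose nonzero eigenvalues are at
  least \<open>\<sigma>\<close>. Counting as in Weyl's inequality: if the perturbation had fewer eigenvalues above \<open>\<sigma>/4\<close> than
  there are nonzero \<open>\<nu>\<^sub>k\<close>, some nonzero vector \<open>w\<close> in the range of the unperturbed matrix would be orthogonal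
  to the eigenvectors of all these, and the two quadratic forms at \<open>w\<close> would differ by at least \<open>3/4 \<sigma> \<parallel>w\<parallel>\<^sup>2\<close>.
\<close>

lemma card_large_eigenvalues_ge_rank:
  fixes C :: "real^'d::finite^'d"
  assumes C: "orthogonal_matrix C" and "0 < \<sigma>"
    and gap: "\<And>k. \<nu> k \<noteq> 0 \<Longrightarrow> \<sigma> \<le> \<nu> k"
    and small: "norm (diag \<mu> - C ** diag \<nu> ** transpose C) < 3 / 4 * \<sigma>"
  shows "card {k. \<nu> k \<noteq> 0} \<le> card {i. \<sigma> / 4 < \<mu> i}"
proof (rule ccontr)
  define T where "T = {i. \<sigma> / 4 < \<mu> i}"
  define S :: "(real^'d) set" where "S = {u. \<forall>k. k \<notin> {k. \<nu> k \<noteq> 0} \<longrightarrow> u $ k = 0}"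
  assume "\<not> card {k. \<nu> k \<noteq> 0} \<le> card {i. \<sigma> / 4 < \<mu> i}"
  then have less: "card T < dim S"
    unfolding S_def T_def dim_coordinate_subspace by (simp only: not_le)
  \<comment> \<open>Coordinates of \<open>C u\<close> along the large eigenvectors; its image is too small for it to be injective on \<open>S\<close>.\<close>
  define f :: "real^'d \<Rightarrow> real^'d" where "f u = (\<chi> i. if i \<in> T then (C *v u) $ i else 0)" for u
  have f: "linear f"
    by (rule linearI) (auto simp: f_def vec_eq_iff matrix_vector_right_distrib matrix_vector_mult_scaleR)
  have S: "subspace S" by (auto simp: S_def subspace_def)
  have "dim (f ` S) \<le> dim {x::real^'d. \<forall>i. i \<notin> T \<longrightarrow> x $ i = 0}"
    by (intro dim_subset) (auto simp: f_def)
  also have "\<dots> = card T"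
    by (rule dim_coordinate_subspace)
  finally have "dim (f ` S) \<noteq> dim S" using less by simp
  then have "\<not> inj_on f S"
    using dim_image_eq[OF f, of S] span_eq_iff[THEN iffD2, OF S] by auto
  then obtain u where u: "u \<in> S" "f u = 0" "u \<noteq> 0"
    using linear_injective_on_subspace_0[OF f S] by blast
  define w where "w = C *v u"
  have norm_w: "norm w = norm u" by (simp add: w_def norm_orthogonal_mult_vector[OF C])
  have "transpose C *v w = u"
    using C by (simp add: w_def matrix_vector_mul_assoc orthogonal_matrix_def)
  then have "w \<bullet> (C ** diag \<nu> ** transpose C *v w) = u \<bullet> (diag \<nu> *v u)"
    by (metis dot_lmul_matrix matrix_vector_mul_assoc transpose_matrix_vector)
  also have "\<dots> \<ge> \<sigma> * (norm u)\<^sup>2"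
    unfolding power2_norm_eq_inner inner_vec_def sum_distrib_left
  proof (intro sum_mono)
    fix k
    have "\<sigma> * (u $ k)\<^sup>2 \<le> \<nu> k * (u $ k)\<^sup>2"
      using u(1) gap[of k] by (cases "\<nu> k = 0") (auto simp: S_def mult_right_mono)
    then show "\<sigma> * (u $ k \<bullet> u $ k) \<le> u $ k \<bullet> (diag \<nu> *v u) $ k"
      by (simp add: power2_eq_square algebra_simps)
  qed
  finally have lower: "\<sigma> * (norm u)\<^sup>2 \<le> w \<bullet> (C ** diag \<nu> ** transpose C *v w)" .
  have "w $ i = 0" if "i \<in> T" for i
    using arg_cong[OF u(2), of "\<lambda>x. x $ i"] that by (simp add: f_def w_def)
  then have upper: "w \<bullet> (diag \<mu> *v w) \<le> \<sigma> / 4 * (norm w)\<^sup>2"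
    unfolding power2_norm_eq_inner inner_vec_def sum_distrib_left
  proof (intro sum_mono)
    fix i
    have "\<mu> i * (w $ i)\<^sup>2 \<le> \<sigma> / 4 * (w $ i)\<^sup>2" if "i \<notin> T"
      using that by (intro mult_right_mono) (auto simp: T_def)
    then show "w $ i \<bullet> (diag \<mu> *v w) $ i \<le> \<sigma> / 4 * (w $ i \<bullet> w $ i)"
      using \<open>\<And>i. i \<in> T \<Longrightarrow> w $ i = 0\<close>[of i]
      by (cases "i \<in> T") (auto simp: power2_eq_square mult_ac)
  qed
  let ?D = "diag \<mu> - C ** diag \<nu> ** transpose C"
  have "3 / 4 * \<sigma> * (norm u)\<^sup>2 \<le> - (w \<bullet> (?D *v w))"
    using upper lower by (simp add: norm_w matrix_vector_mult_diff_rdistrib inner_diff)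
  also have "\<dots> \<le> norm w * (norm ?D * norm w)"
    using Cauchy_Schwarz_ineq2[of w "?D *v w"] norm_matrix_vector_mult_le[of ?D w]
    by (smt (verit) mult_left_mono norm_ge_zero)
  also have "\<dots> = norm ?D * (norm u)\<^sup>2" by (simp add: norm_w power2_eq_square)
  finally show False using small u(3) by simp
qed

text \<open>
  The block of \<open>Z\<close> on the small eigenvectors of the perturbed matrix is \<open>\<Sum>\<^sub>k \<nu>\<^sub>k c\<^sub>k c\<^sub>k\<^sup>T\<close>, with \<open>c\<^sub>k\<close> the part of the
  \<open>k\<close>-th eigenvector of \<open>Z\<close> in the span of those small eigenvectors. The entries of \<open>D C\<close> are
  \<open>(\<mu>\<^sub>i - \<nu>\<^sub>k) C\<^sub>i\<^sub>k\<close>, and \<open>\<mu>\<^sub>i \<le> \<sigma>/4\<close> is separated from \<open>\<nu>\<^sub>k \<ge> \<sigma>\<close>, so \<open>c\<^sub>k\<close> is of first order in the perturbation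
  \<open>D\<close>, and its outer square of second order.
\<close>

lemma norm_small_block_le:
  fixes C :: "real^'d::finite^'d"
  assumes C: "orthogonal_matrix C" and "0 < \<sigma>"
    and nonneg: "\<And>k. 0 \<le> \<nu> k" and gap: "\<And>k. \<nu> k \<noteq> 0 \<Longrightarrow> \<sigma> \<le> \<nu> k"
  defines "Z \<equiv> C ** diag \<nu> ** transpose C"
  shows "norm ((\<chi> i j. if \<sigma> / 4 < \<mu> i \<or> \<sigma> / 4 < \<mu> j then 0 else Z $ i $ j) :: real^'d^'d)
    \<le> 16 / 9 * (norm (diag \<mu> - Z))\<^sup>2 / \<sigma>"
proof -
  define D where "D = diag \<mu> - Z"
  \<comment> \<open>One-column matrices, so that outer products are matrix products.\<close>
  define c :: "'d \<Rightarrow> real^1^'d" where "c k = (\<chi> i j. if \<sigma> / 4 < \<mu> i then 0 else C $ i $ k)" for k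
  have "Z ** C = C ** diag \<nu>"
    using C unfolding Z_def by (metis matrix_mul_assoc matrix_mul_rid orthogonal_matrix_def)
  then have DC: "(D ** C) $ i $ k = (\<mu> i - \<nu> k) * C $ i $ k" for i k
    by (simp add: D_def matrix_diff_rdistrib algebra_simps)
  have entry: "\<nu> k * (c k $ i $ j)\<^sup>2 \<le> 16 / (9 * \<sigma>) * ((D ** C) $ i $ k)\<^sup>2" for i j k
  proof (cases "\<nu> k = 0 \<or> \<sigma> / 4 < \<mu> i")
    case True
    then show ?thesis using \<open>0 < \<sigma>\<close> by (auto simp: c_def)
  next
    case False
    then have *: "\<sigma> \<le> \<nu> k" "\<mu> i \<le> \<sigma> / 4" using gap by auto
    then have "3 / 4 * \<nu> k \<le> \<nu> k - \<mu> i" by simp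
    then have "(3 / 4 * \<nu> k)\<^sup>2 \<le> (\<nu> k - \<mu> i)\<^sup>2"
      using nonneg[of k] by (intro power_mono) auto
    moreover have "\<sigma> * \<nu> k \<le> \<nu> k * \<nu> k" using * nonneg[of k] by (intro mult_right_mono) auto
    ultimately have "9 / 16 * (\<sigma> * \<nu> k) \<le> (\<mu> i - \<nu> k)\<^sup>2"
      by (simp add: power2_eq_square algebra_simps)
    then have "9 / 16 * (\<sigma> * \<nu> k) * (C $ i $ k)\<^sup>2 \<le> (\<mu> i - \<nu> k)\<^sup>2 * (C $ i $ k)\<^sup>2"
      by (rule mult_right_mono) simp
    then have "9 * \<sigma> * (\<nu> k * (C $ i $ k)\<^sup>2) \<le> 16 * ((D ** C) $ i $ k)\<^sup>2"
      unfolding DC power_mult_distrib by (simp add: algebra_simps)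
    then show ?thesis
      using False \<open>0 < \<sigma>\<close> by (simp add: c_def pos_le_divide_eq mult.commute)
  qed
  let ?B = "(\<chi> i j. if \<sigma> / 4 < \<mu> i \<or> \<sigma> / 4 < \<mu> j then 0 else Z $ i $ j) :: real^'d^'d"
  have Z_entry: "Z $ i $ j = (\<Sum>k\<in>UNIV. \<nu> k * (C $ i $ k * C $ j $ k))" for i j
    by (simp add: Z_def matrix_matrix_mult_def[of "C ** diag \<nu>"] transpose_def mult_ac)
  have outer: "(c k ** transpose (c k)) $ i $ j = c k $ i $ 1 * c k $ j $ 1" for i j k
    by (simp add: matrix_matrix_mult_def transpose_def)
  have "?B = (\<Sum>k\<in>UNIV. \<nu> k *\<^sub>R (c k ** transpose (c k)))"
    by (simp add: vec_eq_iff outer Z_entry) (simp add: c_def)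
  then have "norm ?B \<le> (\<Sum>k\<in>UNIV. norm (\<nu> k *\<^sub>R (c k ** transpose (c k))))"
    by (simp only: norm_sum)
  also have "\<dots> \<le> (\<Sum>k\<in>UNIV. \<nu> k * (norm (c k))\<^sup>2)"
    using nonneg norm_matrix_mult_transpose_le[of "c _" "c _"]
    by (intro sum_mono) (simp add: mult_left_mono power2_eq_square)
  also have "\<dots> = (\<Sum>k\<in>UNIV. \<Sum>i\<in>UNIV. \<nu> k * (c k $ i $ 1)\<^sup>2)"
    by (simp add: frobenius_norm_power2 sum_distrib_left)
  also have "\<dots> \<le> (\<Sum>k\<in>UNIV. \<Sum>i\<in>UNIV. 16 / (9 * \<sigma>) * ((D ** C) $ i $ k)\<^sup>2)"
    by (intro sum_mono entry)
  also have "\<dots> = 16 / (9 * \<sigma>) * (norm (D ** C))\<^sup>2"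
    unfolding frobenius_norm_power2 sum_distrib_left by (rule sum.swap)
  finally show ?thesis
    by (simp add: norm_orthogonal_mult_right[OF C] D_def)
qed

section \<open>The damped resolvent\<close>

text \<open>
  For a diagonal \<open>z\<close> the equation for \<open>Y\<close> decouples into scalar equations for its entries. \<open>Y1\<close> collects the
  rows and columns of the large eigenvalues (\<open>T\<close>), \<open>Y2\<close> the rest. The rank of \<open>Y2\<close> is counted by splitting off
  the rows and columns of the small nonzero eigenvalues (\<open>B\<close>): on the kernel of \<open>z\<close> the damping factor is \<open>1\<close>
  and \<open>Y2\<close> is a compression of \<open>- Z\<close>, of rank at most \<open>rs\<close>. As \<open>rs \<le> card T\<close> and \<open>card T + card B \<le> r\<close>, the total is at
  most \<open>2 card B + rs \<le> 2 r\<close>.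
\<close>

lemma resolvent_split_diagonal:
  fixes C :: "real^'d::finite^'d" and \<mu> \<nu> :: "'d \<Rightarrow> real" and l \<sigma> :: real
  assumes C: "orthogonal_matrix C" and \<sigma>: "0 < \<sigma>" and l: "0 < l"
    and \<mu>: "\<And>i. 0 \<le> \<mu> i" and r: "card {i. \<mu> i \<noteq> 0} \<le> r"
    and \<nu>: "\<And>k. 0 \<le> \<nu> k" and gap: "\<And>k. \<nu> k \<noteq> 0 \<Longrightarrow> \<sigma> \<le> \<nu> k"
  defines "Z \<equiv> C ** diag \<nu> ** transpose C" and "rs \<equiv> card {k. \<nu> k \<noteq> 0}"
  defines "D \<equiv> diag \<mu> - Z"
  assumes small: "norm D < 3 / 4 * \<sigma>"
  obtains Y1 Y2 where
    "transpose Y1 = Y1" "transpose Y2 = Y2"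
    "2 *\<^sub>R (diag \<mu> ** (Y1 + Y2) + (Y1 + Y2) ** diag \<mu>) + l *\<^sub>R (Y1 + Y2) = l *\<^sub>R D"
    "rank Y1 \<le> 2 * r" "rank Y2 \<le> 2 * r"
    "norm Y1 \<le> 2 * l / \<sigma> * norm D"
    "norm Y2 \<le> sqrt (real r - real rs) * l / 4 + 16 / 9 * (norm D)\<^sup>2 / \<sigma>"
proof -
  define T where "T = {i. \<sigma> / 4 < \<mu> i}"
  define B where "B = {i. \<mu> i \<noteq> 0 \<and> \<mu> i \<le> \<sigma> / 4}"
  have T_ge: "rs \<le> card T"
    using card_large_eigenvalues_ge_rank[of C \<sigma> \<nu> \<mu>, OF C \<sigma> gap] small
    unfolding rs_def T_def D_def Z_def by blast
  have "T \<union> B = {i. \<mu> i \<noteq> 0}" "T \<inter> B = {}" using \<sigma> by (auto simp: T_def B_def)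
  then have TB: "card T + card B \<le> r"
    using r card_Un_disjoint[of T B] by simp
  define q where "q i j = l / (l + 2 * (\<mu> i + \<mu> j))" for i j
  have den: "l \<le> l + 2 * (\<mu> i + \<mu> j)" for i j using \<mu>[of i] \<mu>[of j] by simp
  have q01: "0 \<le> q i j" "q i j \<le> 1" for i j
    unfolding q_def using den[of i j] l by (simp_all add: divide_le_eq)
  have q_sym: "q i j = q j i" for i j by (simp add: q_def add.commute)
  have "transpose Z = Z"
    by (simp add: Z_def matrix_transpose_mul matrix_mul_assoc)
  then have Z_sym: "Z $ i $ j = Z $ j $ i" for i j by (metis transpose_eq_self_iff)
  have D_sym: "D $ i $ j = D $ j $ i" for i j using Z_sym by (simp add: D_def)
  define Y1 :: "real^'d^'d" where
    "Y1 = (\<chi> i j. if i \<in> T \<or> j \<in> T then q i j * D $ i $ j else 0)"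
  define Y2 :: "real^'d^'d" where
    "Y2 = (\<chi> i j. if i \<in> T \<or> j \<in> T then 0 else q i j * D $ i $ j)"
  show thesis
  proof
    show "transpose Y1 = Y1" "transpose Y2 = Y2"
      using D_sym q_sym by (auto simp: transpose_eq_self_iff Y1_def Y2_def)
    define Y where "Y = Y1 + Y2"
    have Y: "Y $ i $ j = q i j * D $ i $ j" for i j
      by (simp add: Y_def Y1_def Y2_def)
    have "2 * (\<mu> i * (q i j * x) + q i j * x * \<mu> j) + l * (q i j * x) = l * x" for i j x
    proof -
      have "2 * (\<mu> i * (q i j * x) + q i j * x * \<mu> j) + l * (q i j * x)
          = (l + 2 * (\<mu> i + \<mu> j)) * q i j * x" by (simp add: algebra_simps)
      also have "(l + 2 * (\<mu> i + \<mu> j)) * q i j = l" using den[of i j] l by (simp add: q_def)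
      finally show ?thesis .
    qed
    then show "2 *\<^sub>R (diag \<mu> ** (Y1 + Y2) + (Y1 + Y2) ** diag \<mu>) + l *\<^sub>R (Y1 + Y2) = l *\<^sub>R D"
      unfolding Y_def[symmetric] by (simp add: vec_eq_iff Y)
    have "rank Y1 \<le> 2 * card T"
      by (rule rank_le_rows_cols) (simp add: Y1_def)
    then show "rank Y1 \<le> 2 * r" using TB by simp
    show "norm Y1 \<le> 2 * l / \<sigma> * norm D"
    proof (rule frobenius_norm_le_entrywise)
      fix i j
      have "q i j \<le> 2 * l / \<sigma>" if "i \<in> T \<or> j \<in> T"
      proof -
        have "\<sigma> / 2 \<le> l + 2 * (\<mu> i + \<mu> j)"
          using that \<mu>[of i] \<mu>[of j] l by (auto simp: T_def)
        then have "q i j \<le> l / (\<sigma> / 2)"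
          unfolding q_def using l \<sigma> by (intro divide_left_mono mult_pos_pos) auto
        then show ?thesis by (simp add: mult.commute)
      qed
      then show "\<bar>Y1 $ i $ j\<bar> \<le> 2 * l / \<sigma> * \<bar>D $ i $ j\<bar>"
        using q01[of i j] l \<sigma> mult_right_mono[of "q i j" "2 * l / \<sigma>" "\<bar>D $ i $ j\<bar>"]
        by (auto simp: Y1_def abs_mult)
    qed (use l \<sigma> in simp)
    define R :: "real^'d^'d" where
      "R = (\<chi> i j. if i \<in> B \<or> j \<in> B then Y2 $ i $ j else 0)"
    define J :: "real^'d^'d" where "J = diag (\<lambda>i. if \<mu> i = 0 then 1 else 0)"
    have "Y2 = R + J ** (- Z) ** J"
    proof -
      have "Y2 $ i $ j = (R + J ** (- Z) ** J) $ i $ j" for i j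
        using l \<sigma> by (auto simp: Y2_def R_def J_def T_def B_def D_def q_def)
      then show ?thesis by (simp add: vec_eq_iff)
    qed
    moreover have "rank R \<le> 2 * card B"
      by (rule rank_le_rows_cols) (simp add: R_def)
    moreover have "rank (J ** (- Z) ** J) \<le> rs"
    proof -
      have "- Z = C ** diag (\<lambda>k. - \<nu> k) ** transpose C"
        by (simp add: Z_def vec_eq_iff matrix_matrix_mult_def[of _ "transpose C"] sum_negf)
      then have "rank (- Z) = rs"
        using C by (simp add: rank_diagonalized rank_diag rs_def)
      then show ?thesis by (metis order_trans rank_mul_le_left rank_mul_le_right)
    qed
    ultimately show "rank Y2 \<le> 2 * r"
      using rank_add_le[of R "J ** (- Z) ** J"] TB T_ge by simp
    \<comment> \<open>The damping acts on the two terms of \<open>D = diag \<mu> - Z\<close> separately: \<open>p\<close> is the damped diagonal part and \<open>Q'\<close> the damped part of \<open>Z\<close>.\<close>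
    define p where "p i = (if i \<in> T then 0 else q i i * \<mu> i)" for i
    define Q :: "real^'d^'d" where
      "Q = (\<chi> i j. if \<sigma> / 4 < \<mu> i \<or> \<sigma> / 4 < \<mu> j then 0 else Z $ i $ j)"
    define Q' :: "real^'d^'d" where "Q' = (\<chi> i j. q i j * Q $ i $ j)"
    have "Y2 = diag p - Q'"
      by (auto simp: vec_eq_iff Y2_def p_def Q'_def Q_def D_def T_def algebra_simps)
    then have "norm Y2 \<le> norm (diag p) + norm Q'"
      using norm_triangle_ineq4 by blast
    moreover have "norm Q' \<le> 1 * norm Q"
      using q01 by (intro frobenius_norm_le_entrywise)
        (auto simp: Q'_def abs_mult intro!: mult_left_le_one_le)
    moreover have "norm Q \<le> 16 / 9 * (norm D)\<^sup>2 / \<sigma>"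
      using norm_small_block_le[of C \<sigma> \<nu> \<mu>, OF C \<sigma> \<nu> gap] unfolding Q_def D_def Z_def by blast
    moreover have "norm (diag p) \<le> sqrt (real r - real rs) * l / 4"
    proof -
      have p: "0 \<le> p i" "p i \<le> (if i \<in> B then l / 4 else 0)" for i
      proof -
        show "0 \<le> p i" using q01 \<mu> by (simp add: p_def)
        have "q i i * \<mu> i \<le> l / 4"
          using \<mu>[of i] l by (simp add: q_def divide_le_eq)
        then show "p i \<le> (if i \<in> B then l / 4 else 0)" by (auto simp: p_def B_def T_def)
      qed
      have "(norm (diag p))\<^sup>2 = (\<Sum>i\<in>UNIV. (p i)\<^sup>2)"
        by (simp add: frobenius_norm_power2 if_distrib[of "\<lambda>x. x\<^sup>2"] cong: if_cong)
      also have "\<dots> \<le> (\<Sum>i\<in>UNIV. (if i \<in> B then l / 4 else 0)\<^sup>2)"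
        by (intro sum_mono power_mono p)
      also have "\<dots> = real (card B) * (l / 4)\<^sup>2"
        by (simp add: if_distrib[of "\<lambda>x. x\<^sup>2"] sum.If_cases cong: if_cong)
      also have "\<dots> \<le> (real r - real rs) * (l / 4)\<^sup>2"
        using TB T_ge by (intro mult_right_mono) auto
      finally have "norm (diag p) \<le> sqrt ((real r - real rs) * (l / 4)\<^sup>2)"
        by (rule real_le_rsqrt)
      then show ?thesis using l by (simp add: real_sqrt_mult)
    qed
    ultimately show "norm Y2 \<le> sqrt (real r - real rs) * l / 4 + 16 / 9 * (norm D)\<^sup>2 / \<sigma>"
      by linarith
  qed
qed

section \<open>The Gram map\<close>

definition dgram :: "real^'r::finite^'d::finite \<Rightarrow> real^'r^'d \<Rightarrow> 'd symmat" where
  "dgram X U = symmat_of (X ** transpose U + U ** transpose X)"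

lemma mat_of_dgram: "mat_of (dgram X U) = X ** transpose U + U ** transpose X"
  unfolding dgram_def
  by (rule mat_of_symmat_of) (simp add: transpose_add matrix_transpose_mul add.commute)

lemma linear_dgram: "linear (dgram X)"
  by (rule linearI)
    (simp_all add: symmat_eq_iff mat_of_dgram matrix_mult_linear_simps scaleR_add_right)

lemma gram_add: "gram (X + U) = gram X + dgram X U + gram U"
  by (simp add: symmat_eq_iff mat_of_gram mat_of_dgram matrix_mult_linear_simps)

lemma gram_scaleR: "gram (c *\<^sub>R U) = c\<^sup>2 *\<^sub>R gram U"
  by (simp add: symmat_eq_iff mat_of_gram matrix_mult_linear_simps power2_eq_square)

lemma norm_gram_le: "norm (gram U) \<le> (norm U)\<^sup>2"
  unfolding norm_symmat_def mat_of_gram power2_eq_square by (rule norm_matrix_mult_transpose_le)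

lemma gram_has_derivative: "(gram has_derivative dgram X) (at X)"
proof (unfold has_derivative_at, intro conjI)
  show "bounded_linear (dgram X)"
    using linear_dgram by (simp add: linear_conv_bounded_linear)
  have bound: "norm (gram (X + U) - gram X - dgram X U) / norm U \<le> norm U" for U
    using norm_gram_le[of U] by (cases "U = 0") (simp_all add: gram_add divide_le_eq power2_eq_square)
  show "(\<lambda>U. norm (gram (X + U) - gram X - dgram X U) / norm U) \<midarrow>0\<rightarrow> 0"
    by (rule Lim_null_comparison[OF _ tendsto_norm_zero[OF tendsto_ident_at]])
      (use bound in \<open>auto intro!: always_eventually\<close>)
qed

lemma frechet_derivative_gram: "frechet_derivative gram (at X) = dgram X"
  by (rule sym[OF frechet_derivative_at[OF gram_has_derivative]])

lemma adjoint_dgram: "adjoint (dgram X) = (\<lambda>V. 2 *\<^sub>R (mat_of V ** X))"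
proof (rule adjoint_unique, intro allI)
  fix U V
  have "(X ** transpose U) \<bullet> mat_of V = U \<bullet> (mat_of V ** X)"
    using inner_transpose[of "X ** transpose U" "mat_of V"]
    by (simp add: matrix_transpose_mul inner_matrix_mult_right)
  moreover have "(U ** transpose X) \<bullet> mat_of V = U \<bullet> (mat_of V ** X)"
    by (simp add: inner_matrix_mult_right)
  ultimately show "dgram X U \<bullet> V = U \<bullet> (2 *\<^sub>R (mat_of V ** X))"
    by (simp add: inner_symmat_def mat_of_dgram inner_add_left)
qed

lemma mat_of_dgram_adjoint:
  "mat_of (dgram X (adjoint (dgram X) W))
     = 2 *\<^sub>R (mat_of (gram X) ** mat_of W + mat_of W ** mat_of (gram X))"
  by (simp add: adjoint_dgram mat_of_dgram mat_of_gram matrix_mult_linear_simps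
      matrix_transpose_mul matrix_mul_assoc scaleR_add_right)

lemma rank_factor_le: "rank (A ** B) \<le> CARD('r)"
  for A :: "real^'r::finite^'m::finite" and B :: "real^'n::finite^'r"
  using rank_mul_le_left[of A B] rank_bound[of A] by simp

lemma rank_dgram_le: "rank (mat_of (dgram X U)) \<le> 2 * CARD('r)"
  for X :: "real^'r::finite^'d::finite"
  using rank_add_le[of "X ** transpose U" "U ** transpose X"]
    rank_factor_le[of X "transpose U"] rank_factor_le[of U "transpose X"]
  by (simp add: mat_of_dgram)

lemma rank_gram_le: "rank (mat_of (gram X)) \<le> CARD('r)"
  for X :: "real^'r::finite^'d::finite"
  by (simp add: mat_of_gram rank_factor_le)

lemma rank_symmat_diff_le: "rank (mat_of (A - B)) \<le> rank (mat_of A) + rank (mat_of B)"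
  using rank_add_le[of "mat_of A" "- mat_of B"] by (simp add: rank_minus)

lemma psd_gram: "psd (gram X)"
proof -
  have "x \<bullet> (X ** transpose X *v x) = (transpose X *v x) \<bullet> (transpose X *v x)" for x
    by (metis dot_lmul_matrix matrix_vector_mul_assoc transpose_matrix_vector)
  then show ?thesis by (simp add: psd_def mat_of_gram)
qed

lemma symmat_diagonalization:
  obtains E \<mu> where "orthogonal_matrix E" "mat_of A = E ** diag \<mu> ** transpose E"
  using symmetric_matrix_diagonalization[OF transpose_mat_of] by blast

text \<open>
  A square root \<open>G (diag \<nu>)\<^sup>1\<^sup>/\<^sup>2\<close> has only as many nonzero columns as the rank, so its columns can be
  placed into \<open>CARD('r)\<close> positions.
\<close>

lemma psd_in_range_gram:
  fixes Z :: "'d::finite symmat"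
  assumes "psd Z" and "rank (mat_of Z) \<le> CARD('r::finite)"
  shows "Z \<in> range (gram :: real^'r^'d \<Rightarrow> _)"
proof -
  obtain G \<nu> where G: "orthogonal_matrix G" and Z: "mat_of Z = G ** diag \<nu> ** transpose G"
    by (rule symmat_diagonalization)
  have \<nu>: "0 \<le> \<nu> k" for k by (rule psd_eigenvalues_nonneg[OF G Z \<open>psd Z\<close>])
  have "card {k. \<nu> k \<noteq> 0} \<le> card (UNIV :: 'r set)"
    using assms(2) by (simp add: Z rank_diagonalized[OF G] rank_diag)
  then obtain f :: "'d \<Rightarrow> 'r" where f: "inj_on f {k. \<nu> k \<noteq> 0}"
    using inj_on_iff_card_le[of "{k. \<nu> k \<noteq> 0}" "UNIV :: 'r set"] by auto
  \<comment> \<open>The nonzero columns of the diagonal square root, relabelled along \<open>f\<close>.\<close>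
  define M :: "real^'r^'d" where "M = (\<chi> k a. if \<nu> k \<noteq> 0 \<and> f k = a then sqrt (\<nu> k) else 0)"
  have "(M ** transpose M) $ k $ l = diag \<nu> $ k $ l" for k l
  proof -
    have "M $ k $ a * M $ l $ a = (if a = f k then diag \<nu> $ k $ l else 0)" for a
    proof (cases "k = l")
      case True
      then show ?thesis using \<nu>[of k] by (simp add: M_def)
    next
      case False
      then have "\<not> (\<nu> k \<noteq> 0 \<and> \<nu> l \<noteq> 0 \<and> f k = f l)"
        using inj_onD[OF f, of k l] by blast
      then show ?thesis using False by (auto simp: M_def)
    qed
    then show ?thesis by (simp add: matrix_matrix_mult_def transpose_def)
  qed
  then have "M ** transpose M = diag \<nu>" by (simp add: vec_eq_iff)
  moreover have "(G ** M) ** transpose (G ** M) = G ** (M ** transpose M) ** transpose G"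
    by (simp only: matrix_transpose_mul matrix_mul_assoc)
  ultimately have "gram (G ** M) = Z"
    by (simp only: symmat_eq_iff mat_of_gram Z)
  then show ?thesis by blast
qed

text \<open>
  The diagonal case, transported by the conjugation with the eigenvector matrix of \<open>gram X\<close>, which preserves
  rank, symmetry and the Frobenius norm.
\<close>

lemma resolvent_split:
  fixes X :: "real^'r::finite^'d::finite" and Zs :: "'d symmat" and l :: real
  assumes psd: "psd Zs" and rs: "rank (mat_of Zs) = rs" "1 \<le> rs" and l: "0 < l"
  defines "\<sigma> \<equiv> eigval rs Zs" and "D \<equiv> gram X - Zs"
  assumes small: "norm D < 3 / 4 * \<sigma>"
  obtains Y1 Y2 where
    "dgram X (adjoint (dgram X) (Y1 + Y2)) + l *\<^sub>R (Y1 + Y2) = l *\<^sub>R D"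
    "rank (mat_of Y1) \<le> 2 * CARD('r)" "rank (mat_of Y2) \<le> 2 * CARD('r)"
    "norm Y1 \<le> 2 * l / \<sigma> * norm D"
    "norm Y2 \<le> sqrt (real CARD('r) - real rs) * l / 4 + 16 / 9 * (norm D)\<^sup>2 / \<sigma>"
proof -
  obtain E \<mu> where E: "orthogonal_matrix E" and z: "mat_of (gram X) = E ** diag \<mu> ** transpose E"
    by (rule symmat_diagonalization)
  obtain G \<nu> where G: "orthogonal_matrix G" and Z: "mat_of Zs = G ** diag \<nu> ** transpose G"
    by (rule symmat_diagonalization)
  have \<mu>: "0 \<le> \<mu> i" for i by (rule psd_eigenvalues_nonneg[OF E z psd_gram])
  have \<nu>: "0 \<le> \<nu> i" for i by (rule psd_eigenvalues_nonneg[OF G Z psd])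
  have "0 < \<sigma>" and gap: "\<nu> k \<noteq> 0 \<Longrightarrow> \<sigma> \<le> \<nu> k" for k
    unfolding \<sigma>_def using eigval_diagonalized[OF G Z \<nu> rs] by auto
  have r: "card {i. \<mu> i \<noteq> 0} \<le> CARD('r)"
    using rank_gram_le[of X] by (simp add: z rank_diagonalized[OF E] rank_diag)
  have rs': "card {k. \<nu> k \<noteq> 0} = rs"
    using rs(1) by (simp add: Z rank_diagonalized[OF G] rank_diag)
  define C where "C = transpose E ** G"
  have C: "orthogonal_matrix C"
    using E G by (simp add: C_def orthogonal_matrix_mul)
  have EE: "transpose E ** E = mat 1" "E ** transpose E = mat 1"
    using E by (simp_all add: orthogonal_matrix_def)
  have conj: "E ** (transpose E ** M ** E) ** transpose E = M" for M
  proof -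
    have "E ** (transpose E ** M ** E) ** transpose E = (E ** transpose E) ** M ** (E ** transpose E)"
      by (simp only: matrix_mul_assoc)
    then show ?thesis by (simp add: EE)
  qed
  let ?D = "diag \<mu> - C ** diag \<nu> ** transpose C"
  have D: "mat_of D = E ** ?D ** transpose E"
  proof -
    have "C ** diag \<nu> ** transpose C = transpose E ** mat_of Zs ** E"
      by (simp only: C_def Z matrix_transpose_mul transpose_transpose matrix_mul_assoc)
    then have "E ** (C ** diag \<nu> ** transpose C) ** transpose E = mat_of Zs"
      by (simp only: conj)
    then show ?thesis by (simp add: D_def z matrix_diff_ldistrib matrix_diff_rdistrib)
  qed
  have norm_conj: "norm (E ** M ** transpose E) = norm M" for M :: "real^'d^'d"
    using E by (simp add: norm_orthogonal_mult_left norm_orthogonal_mult_right)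
  have norm_D: "norm ?D = norm D"
    by (simp only: norm_symmat_def D norm_conj)
  obtain Y1 Y2 where Y:
    "transpose Y1 = Y1" "transpose Y2 = Y2"
    "2 *\<^sub>R (diag \<mu> ** (Y1 + Y2) + (Y1 + Y2) ** diag \<mu>) + l *\<^sub>R (Y1 + Y2) = l *\<^sub>R ?D"
    "rank Y1 \<le> 2 * CARD('r)" "rank Y2 \<le> 2 * CARD('r)"
    "norm Y1 \<le> 2 * l / \<sigma> * norm ?D"
    "norm Y2 \<le> sqrt (real CARD('r) - real (card {k. \<nu> k \<noteq> 0})) * l / 4 + 16 / 9 * (norm ?D)\<^sup>2 / \<sigma>"
    using resolvent_split_diagonal[of C \<sigma> l \<mu> "CARD('r)" \<nu>, OF C \<open>0 < \<sigma>\<close> l \<mu> r \<nu> gap] small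
    unfolding norm_D by blast
  define S where "S M = symmat_of (E ** M ** transpose E)" for M
  have S: "mat_of (S M) = E ** M ** transpose E" if "transpose M = M" for M
    unfolding S_def using that
    by (intro mat_of_symmat_of) (simp add: matrix_transpose_mul matrix_mul_assoc)
  have conj_mult: "(E ** A ** transpose E) ** (E ** B ** transpose E) = E ** (A ** B) ** transpose E" for A B
  proof -
    have "(E ** A ** transpose E) ** (E ** B ** transpose E)
        = E ** A ** (transpose E ** E) ** B ** transpose E"
      by (simp only: matrix_mul_assoc)
    then show ?thesis by (simp add: EE matrix_mul_assoc)
  qed
  show thesis
  proof (rule that[of "S Y1" "S Y2"])
    have sym: "transpose (Y1 + Y2) = Y1 + Y2" by (simp add: transpose_add Y(1,2))
    have "S Y1 + S Y2 = S (Y1 + Y2)"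
      by (simp add: symmat_eq_iff S Y(1,2) sym matrix_add_ldistrib matrix_add_rdistrib)
    moreover have "mat_of (dgram X (adjoint (dgram X) (S (Y1 + Y2))) + l *\<^sub>R S (Y1 + Y2))
        = E ** (2 *\<^sub>R (diag \<mu> ** (Y1 + Y2) + (Y1 + Y2) ** diag \<mu>) + l *\<^sub>R (Y1 + Y2)) ** transpose E"
      unfolding mat_of_add mat_of_scaleR mat_of_dgram_adjoint S[OF sym] z conj_mult
      by (simp add: matrix_mult_linear_simps scaleR_add_right)
    ultimately show "dgram X (adjoint (dgram X) (S Y1 + S Y2)) + l *\<^sub>R (S Y1 + S Y2) = l *\<^sub>R D"
      unfolding Y(3) symmat_eq_iff[of "_ + _" "l *\<^sub>R D"]
      by (simp only: mat_of_scaleR[of l D] D matrix_mult_linear_simps)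
  qed (use Y in \<open>simp_all add: S rank_diagonalized[OF E] norm_symmat_def norm_conj norm_D[symmetric] D rs'\<close>)
qed

section \<open>Damped Gauss-Newton directions\<close>

lemma orth_proj:
  fixes S :: "'y::euclidean_space set"
  assumes "subspace S"
  shows orth_proj_in: "orth_proj S v \<in> S"
    and orth_proj_inner: "w \<in> S \<Longrightarrow> v \<bullet> w = orth_proj S v \<bullet> w"
proof -
  obtain p z where p: "p \<in> span S" "\<And>w. w \<in> span S \<Longrightarrow> orthogonal z w" "v = p + z"
    using orthogonal_subspace_decomp_exists[of S v] by metis
  have S: "span S = S" using assms by (simp only: span_eq_iff)
  have "\<exists>!p. p \<in> S \<and> v - p \<in> orthogonal_comp S"
  proof (rule ex1I[of _ p])
    show "p \<in> S \<and> v - p \<in> orthogonal_comp S"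
      using p S by (auto simp: orthogonal_comp_def orthogonal_commute)
    fix p' assume p': "p' \<in> S \<and> v - p' \<in> orthogonal_comp S"
    then have "p' - p \<in> S" using p(1) S assms by (simp add: subspace_diff)
    then have "(p' - p) \<bullet> (v - p') = 0" "(p' - p) \<bullet> (v - p) = 0"
      using p(2)[of "p' - p"] p(3) p' S
      by (auto simp: orthogonal_comp_def orthogonal_def inner_commute)
    then have "(p' - p) \<bullet> (p' - p) = 0" by (simp add: inner_diff)
    then show "p' = p" by simp
  qed
  from theI'[OF this] have *: "orth_proj S v \<in> S" "v - orth_proj S v \<in> orthogonal_comp S"
    unfolding orth_proj_def by auto
  show "orth_proj S v \<in> S" by (rule *(1))
  show "v \<bullet> w = orth_proj S v \<bullet> w" if "w \<in> S"
    using *(2) that by (auto simp: orthogonal_comp_def orthogonal_def inner_diff inner_commute)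
qed

lemma damped_normal_equation:
  fixes D :: "'e::euclidean_space \<Rightarrow> 'y::euclidean_space" and v :: 'y
  assumes D: "linear D" and "0 < l"
  defines "U \<equiv> inv (\<lambda>u. adjoint D (D u) + l *\<^sub>R u) (adjoint D v)"
  shows "adjoint D (D U) + l *\<^sub>R U = adjoint D v"
proof -
  let ?N = "\<lambda>u. adjoint D (D u) + l *\<^sub>R u"
  note adj = adjoint_works[OF D]
  have N: "linear ?N"
    by (intro linear_compose_add linear_compose_scale_right linear_ident
        linear_compose[OF D adjoint_linear[OF D], unfolded comp_def])
  have "inj ?N"
  proof (rule iffD2[OF linear_injective_0[OF N]], intro allI impI)
    fix u assume "?N u = 0"
    then have "u \<bullet> ?N u = 0" by simp
    then have "D u \<bullet> D u + l * (u \<bullet> u) = 0"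
      using adj[of u "D u"] by (simp add: inner_add_right)
    then have "l * (u \<bullet> u) \<le> 0" by (smt (verit) inner_ge_zero)
    then have "u \<bullet> u \<le> 0" using \<open>0 < l\<close> by (simp add: mult_le_0_iff)
    then show "u = 0" by (metis inner_gt_zero_iff not_less)
  qed
  then have "surj ?N" by (rule linear_inj_imp_surj[OF N])
  then show ?thesis unfolding U_def by (rule surj_f_inv_f)
qed

text \<open>
  Pairing the equation for \<open>U\<close> with \<open>U\<close> gives \<open>\<parallel>D U\<parallel>\<^sup>2 + l \<parallel>U\<parallel>\<^sup>2 \<le> p \<parallel>D U\<parallel>\<close>, because \<open>v\<close> enters only through its
  projection onto the range of \<open>D\<close>; then \<open>p x - x\<^sup>2 \<le> p\<^sup>2/4\<close>.
\<close>

lemma damped_direction_bounds: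
  fixes D :: "'e::euclidean_space \<Rightarrow> 'y::euclidean_space"
  assumes D: "linear D" and l: "0 < l" and U: "adjoint D (D U) + l *\<^sub>R U = adjoint D v"
  defines "p \<equiv> norm (orth_proj (range D) v)"
  shows "norm (D U) \<le> p" and "(norm U)\<^sup>2 \<le> p\<^sup>2 / (4 * l)"
proof -
  have "(norm (D U))\<^sup>2 + l * (norm U)\<^sup>2 = U \<bullet> (adjoint D (D U) + l *\<^sub>R U)"
    using adjoint_works[OF D, of U "D U"] by (simp add: inner_add_right power2_norm_eq_inner)
  also have "\<dots> = v \<bullet> D U"
    unfolding U using adjoint_works[OF D, of U v] by (simp add: inner_commute)
  also have "\<dots> = orth_proj (range D) v \<bullet> D U"
    using D by (intro orth_proj_inner) (auto intro: linear_subspace_image)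
  also have "\<dots> \<le> p * norm (D U)"
    unfolding p_def by (rule norm_cauchy_schwarz)
  finally have *: "(norm (D U))\<^sup>2 + l * (norm U)\<^sup>2 \<le> p * norm (D U)" .
  have "0 \<le> l * (norm U)\<^sup>2" using l by simp
  with * have "norm (D U) * norm (D U) \<le> p * norm (D U)" by (simp add: power2_eq_square)
  then show "norm (D U) \<le> p"
    by (cases "norm (D U) = 0") (simp_all add: p_def)
  have "0 \<le> (p - 2 * norm (D U))\<^sup>2" by simp
  with * have "4 * (l * (norm U)\<^sup>2) \<le> p\<^sup>2" by (simp add: power2_eq_square algebra_simps)
  then show "(norm U)\<^sup>2 \<le> p\<^sup>2 / (4 * l)" using l by (simp add: pos_le_divide_eq mult_ac)
qed

text \<open>
  The damped projection \<open>D (D\<^sup>*D + l)\<^sup>-\<^sup>1 D\<^sup>*\<close> is self-adjoint and differs from the identity by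
  \<open>l (D D\<^sup>* + l)\<^sup>-\<^sup>1\<close>, so \<open>Y\<close> measures what the damping loses on \<open>\<delta>\<close>.
\<close>

lemma damped_direction_inner:
  fixes D :: "'e::euclidean_space \<Rightarrow> 'y::euclidean_space"
  assumes D: "linear D" and l: "0 < l" and U: "adjoint D (D U) + l *\<^sub>R U = adjoint D v"
    and Y: "D (adjoint D Y) + l *\<^sub>R Y = l *\<^sub>R \<delta>"
  shows "D U \<bullet> \<delta> = v \<bullet> \<delta> - v \<bullet> Y"
proof -
  note adj = adjoint_works[OF D]
  have "l * (D U \<bullet> \<delta>) = D U \<bullet> (D (adjoint D Y) + l *\<^sub>R Y)" by (simp add: Y)
  also have "\<dots> = (adjoint D (D U) + l *\<^sub>R U) \<bullet> adjoint D Y"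
    using adj[of "adjoint D Y" "D U"] adj[of U Y]
    by (simp add: inner_add inner_commute algebra_simps)
  also have "\<dots> = v \<bullet> (D (adjoint D Y) + l *\<^sub>R Y) - l * (v \<bullet> Y)"
    unfolding U using adj[of "adjoint D Y" v] by (simp add: inner_add_right inner_commute)
  also have "\<dots> = l * (v \<bullet> \<delta> - v \<bullet> Y)"
    unfolding Y by (simp add: algebra_simps)
  finally show ?thesis using l by simp
qed

section \<open>Descent of a Polyak step\<close>

text \<open>
  Put \<open>s = t a\<close>, so that \<open>t\<^sup>2 \<pi>\<^sup>2 = g s \<le> s\<close>. The linear part satisfies
  \<open>\<parallel>\<delta> - t p\<parallel>\<^sup>2 \<le> \<parallel>\<delta>\<parallel>\<^sup>2 - 3/2 s + s\<close>, and the damping makes \<open>\<parallel>t\<^sup>2 q\<parallel> \<le> s / (8 \<parallel>\<delta>\<parallel>)\<close>, which costs at most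
  \<open>s/4 + s/36\<close> on expanding the square; alignment also forces \<open>s \<le> 16/9 \<parallel>\<delta>\<parallel>\<^sup>2\<close>, which tames the last term.
\<close>

lemma polyak_descent:
  fixes \<delta> p q :: "'a::real_inner"
  assumes "0 < norm \<delta>" "0 < a" "0 < g" "g \<le> 1" "g \<le> C / 2"
    and l: "C * norm \<delta> \<le> l"
    and t: "t = g * (a / \<pi>\<^sup>2)"
    and p: "norm p \<le> \<pi>" and q: "norm q \<le> \<pi>\<^sup>2 / (4 * l)"
    and align: "3 / 4 * a \<le> p \<bullet> \<delta>"
  shows "(norm (\<delta> - t *\<^sub>R p + t\<^sup>2 *\<^sub>R q))\<^sup>2 \<le> (norm \<delta>)\<^sup>2 - g * a\<^sup>2 / \<pi>\<^sup>2 / 8"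
proof -
  define n where "n = norm \<delta>"
  define s where "s = t * a"
  have n: "0 < n" using assms by (simp add: n_def)
  have "3 / 4 * a \<le> norm p * n"
    using align norm_cauchy_schwarz[of p \<delta>] by (simp add: n_def)
  also have "\<dots> \<le> \<pi> * n" using p n by simp
  finally have a_le: "3 / 4 * a \<le> \<pi> * n" .
  then have "0 < \<pi> * n" using \<open>0 < a\<close> by linarith
  then have \<pi>: "0 < \<pi>" using n by (simp add: zero_less_mult_iff)
  have t\<pi>: "t * \<pi>\<^sup>2 = g * a" using \<pi> by (simp add: t)
  have t0: "0 < t" using \<pi> assms by (simp add: t)
  have s0: "0 < s" using t0 \<open>0 < a\<close> by (simp add: s_def)
  have t2: "t\<^sup>2 * \<pi>\<^sup>2 = g * s"
    using t\<pi> by (simp add: s_def power2_eq_square)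
  have s_le: "s \<le> 16 / 9 * n\<^sup>2"
  proof -
    have "(3 / 4 * a)\<^sup>2 \<le> (\<pi> * n)\<^sup>2" using a_le \<open>0 < a\<close> by (intro power_mono) auto
    then have "a\<^sup>2 \<le> 16 / 9 * (\<pi>\<^sup>2 * n\<^sup>2)" by (simp add: power_mult_distrib power_divide)
    moreover have "g * a\<^sup>2 \<le> 1 * a\<^sup>2" using \<open>g \<le> 1\<close> by (intro mult_right_mono) auto
    moreover have "s * \<pi>\<^sup>2 = g * a\<^sup>2"
      using t\<pi> by (simp add: s_def power2_eq_square)
    ultimately have "s * \<pi>\<^sup>2 \<le> (16 / 9 * n\<^sup>2) * \<pi>\<^sup>2" by (simp add: mult_ac)
    then show ?thesis using \<pi> by simp
  qed
  define e where "e = \<delta> - t *\<^sub>R p"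
  have "t * (3 / 4 * a) \<le> t * (p \<bullet> \<delta>)" using align t0 by (intro mult_left_mono) auto
  moreover have "t\<^sup>2 * (norm p)\<^sup>2 \<le> s"
  proof -
    have "t\<^sup>2 * (norm p)\<^sup>2 \<le> t\<^sup>2 * \<pi>\<^sup>2" using p by (intro mult_left_mono power_mono) auto
    also have "\<dots> \<le> s" unfolding t2 using \<open>g \<le> 1\<close> s0 by simp
    finally show ?thesis .
  qed
  moreover have "(norm e)\<^sup>2 = n\<^sup>2 - 2 * (t * (p \<bullet> \<delta>)) + t\<^sup>2 * (norm p)\<^sup>2"
    unfolding e_def n_def power2_norm_eq_inner
    by (simp add: inner_diff_left inner_diff_right inner_commute[of \<delta> p] power2_eq_square
        right_diff_distrib)
  ultimately have e2: "(norm e)\<^sup>2 \<le> n\<^sup>2 - s / 2" by (simp add: s_def mult_ac)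
  then have "(norm e)\<^sup>2 \<le> n\<^sup>2" using s0 by simp
  then have e_le: "norm e \<le> n" by (rule power2_le_imp_le) (use n in simp)
  define w where "w = s / (8 * n)"
  have w: "norm (t\<^sup>2 *\<^sub>R q) \<le> w"
  proof -
    have C: "0 < C" "2 * g \<le> C" using assms by auto
    then have l0: "0 < l" using l n by (smt (verit) mult_pos_pos n_def)
    have "norm (t\<^sup>2 *\<^sub>R q) \<le> t\<^sup>2 * (\<pi>\<^sup>2 / (4 * l))"
      using mult_left_mono[OF q, of "t\<^sup>2"] by simp
    also have "\<dots> = g * s / (4 * l)" by (simp add: t2[symmetric])
    also have "\<dots> \<le> w"
    proof -
      have "2 * g * n \<le> l" using l C n by (smt (verit) mult_right_mono n_def)
      then have "2 * g * n * s \<le> l * s" using s0 by (intro mult_right_mono) auto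
      then show ?thesis using l0 n by (simp add: w_def field_simps)
    qed
    finally show ?thesis .
  qed
  have "(norm (e + t\<^sup>2 *\<^sub>R q))\<^sup>2 \<le> (norm e + w)\<^sup>2"
    using norm_triangle_ineq[of e "t\<^sup>2 *\<^sub>R q"] w by (intro power_mono) auto
  also have "\<dots> = (norm e)\<^sup>2 + 2 * (norm e * w) + w\<^sup>2" by (simp add: power2_sum)
  also have "\<dots> \<le> (n\<^sup>2 - s / 2) + 2 * (n * w) + w\<^sup>2"
    using e2 e_le s0 n by (intro add_mono mult_left_mono mult_right_mono) (auto simp: w_def)
  also have "n * w = s / 8" using n by (simp add: w_def)
  also have "w\<^sup>2 \<le> s / 36"
  proof -
    have "s * s \<le> s * (16 / 9 * n\<^sup>2)" using s_le s0 by (intro mult_left_mono) auto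
    then show ?thesis using n by (simp add: w_def power_divide power_mult_distrib divide_le_eq power2_eq_square)
  qed
  finally have "(norm (e + t\<^sup>2 *\<^sub>R q))\<^sup>2 \<le> n\<^sup>2 - s / 8" using s0 by simp
  moreover have "s = g * a\<^sup>2 / \<pi>\<^sup>2" by (simp add: s_def t power2_eq_square)
  ultimately show ?thesis by (simp add: e_def n_def)
qed

text \<open>
  Alignment is where the constants are spent. With \<open>\<rho> = \<omega>0 / \<omega>2\<close>, the error norm \<open>n\<close> and \<open>\<sigma> = eigval rs Zs\<close>,
  closeness gives \<open>n \<le> \<rho> \<sigma> / 11\<close> and the bound on \<open>K\<close> gives
  \<open>l \<sqrt>(2 (r - rs + 1)) \<le> \<rho> n / 16\<close>. The three contributions to \<open>\<parallel>Y1\<parallel> + \<parallel>Y2\<parallel>\<close> are then at most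
  \<open>\<rho> n / 88\<close>, \<open>\<rho> n / 64\<close> and \<open>16 \<rho> n / 99\<close>, together less than \<open>\<rho> n / 4\<close>, so \<open>v \<bullet> Y\<close> is at most a quarter of
  \<open>\<omega>0 n\<close> and hence of \<open>h (gram X) - h Zs\<close>.
\<close>

lemma lmm_step_contraction:
  fixes X :: "real^'r::finite^'d::finite" and Zs v :: "'d symmat" and h :: "'d symmat \<Rightarrow> real"
  assumes psd: "psd Zs" and rs: "rank (mat_of Zs) = rs" "1 \<le> rs" "rs \<le> CARD('r)"
    and \<omega>: "0 < \<omega>0" "\<omega>0 \<le> \<omega>2"
    and v: "v \<in> subdifferential h (gram X)"
    and v_le: "\<And>W. rank (mat_of W) \<le> 2 * CARD('r) \<Longrightarrow> v \<bullet> W \<le> \<omega>2 * norm W"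
    and sharp: "\<omega>0 * norm (gram X - Zs) \<le> h (gram X) - h Zs"
    and close: "norm (gram X - Zs) \<le> 1 / (8 * sqrt 2) * (\<omega>0 / \<omega>2) * eigval rs Zs"
    and ne: "gram X \<noteq> Zs"
    and g: "0 < g" "g \<le> min 1 (C / 2)" and C: "0 < C"
    and K: "K \<le> 1 / (16 * sqrt (2 * (real CARD('r) - real rs + 1))) * (\<omega>0\<^sup>2 / \<omega>2\<^sup>2)"
    and l: "C * norm (gram X - Zs) \<le> l" "l \<le> K * norm (gram X - Zs)"
    and t: "t = g * ((h (gram X) - h Zs) / (norm (orth_proj (range (dgram X)) v))\<^sup>2)"
  shows "(norm (gram (lmm_step gram t l X v) - Zs))\<^sup>2
    \<le> (1 - g / 8 * (\<omega>0\<^sup>2 / \<omega>2\<^sup>2)) * (norm (gram X - Zs))\<^sup>2"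
proof -
  define \<delta> where "\<delta> = gram X - Zs"
  define n where "n = norm \<delta>"
  define \<sigma> where "\<sigma> = eigval rs Zs"
  define \<rho> where "\<rho> = \<omega>0 / \<omega>2"
  define a where "a = h (gram X) - h Zs"
  define \<pi> where "\<pi> = norm (orth_proj (range (dgram X)) v)"
  note D = linear_dgram[of X]
  have n: "0 < n" using ne by (simp add: n_def \<delta>_def)
  have \<rho>: "0 < \<rho>" "\<rho> \<le> 1" using \<omega> by (simp_all add: \<rho>_def)
  have l0: "0 < l" using l(1) C n by (smt (verit) mult_pos_pos n_def \<delta>_def)
  have a: "\<omega>0 * n \<le> a" "0 < a"
    using sharp mult_pos_pos[OF \<omega>(1) n] by (simp_all add: a_def n_def \<delta>_def)
  have n_le: "n \<le> \<rho> * \<sigma> / 11"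
  proof -
    have "n \<le> \<rho> * \<sigma> / (8 * sqrt 2)" using close by (simp add: n_def \<delta>_def \<rho>_def \<sigma>_def mult_ac)
    moreover from this have "0 < \<rho> * \<sigma>" using n by (smt (verit) divide_nonpos_pos real_sqrt_gt_0_iff)
    moreover have "11 \<le> 8 * sqrt 2"
    proof -
      have "11 / 8 \<le> sqrt (2::real)" by (rule real_le_rsqrt) (simp add: power2_eq_square)
      then show ?thesis by simp
    qed
    ultimately show ?thesis by (smt (verit) frac_le)
  qed
  have "0 < \<rho> * \<sigma>" using n n_le by simp
  then have \<sigma>: "0 < \<sigma>" using \<rho> by (simp add: zero_less_mult_iff)
  have n_small: "n < 3 / 4 * \<sigma>"
    using n_le mult_right_mono[of \<rho> 1 \<sigma>] \<rho> \<sigma> by linarith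
  define k where "k = real CARD('r) - real rs"
  have k: "0 \<le> k" using rs(3) by (simp add: k_def)
  define S where "S = sqrt (2 * (k + 1))"
  have S: "1 \<le> S" "sqrt k \<le> S" using k by (simp_all add: S_def)
  have Sl: "S * l \<le> \<rho> * n / 16"
  proof -
    have "l \<le> (1 / (16 * S) * \<rho>\<^sup>2) * n"
      using l(2) K n by (smt (verit) mult_right_mono n_def \<delta>_def S_def k_def \<rho>_def power_divide)
    then have "S * l \<le> S * ((1 / (16 * S) * \<rho>\<^sup>2) * n)" using S by (intro mult_left_mono) auto
    also have "\<dots> = \<rho>\<^sup>2 * n / 16" using S by simp
    also have "\<rho>\<^sup>2 * n \<le> \<rho> * n"
      using \<rho> n by (intro mult_right_mono) (auto simp: power2_eq_square)
    finally show ?thesis by simp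
  qed
  obtain Y1 Y2 where Y: "dgram X (adjoint (dgram X) (Y1 + Y2)) + l *\<^sub>R (Y1 + Y2) = l *\<^sub>R \<delta>"
    "rank (mat_of Y1) \<le> 2 * CARD('r)" "rank (mat_of Y2) \<le> 2 * CARD('r)"
    "norm Y1 \<le> 2 * l / \<sigma> * n"
    "norm Y2 \<le> sqrt k * l / 4 + 16 / 9 * n\<^sup>2 / \<sigma>"
    using resolvent_split[OF psd rs(1,2) l0, of X] n_small
    unfolding \<delta>_def n_def \<sigma>_def k_def by blast
  have "norm Y1 + norm Y2 \<le> \<rho> * n / 4"
  proof -
    have n_div: "n / \<sigma> \<le> \<rho> / 11" using n_le \<sigma> by (simp add: divide_le_eq)
    have l_le: "l \<le> \<rho> * n / 16"
      using Sl mult_right_mono[OF S(1), of l] l0 by linarith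
    have "2 * l / \<sigma> * n = 2 * l * (n / \<sigma>)" by simp
    also have "\<dots> \<le> 2 * (\<rho> * n / 16) * (1 / 11)"
    proof (rule mult_mono)
      show "n / \<sigma> \<le> 1 / 11" using n_div \<rho> by linarith
    qed (use l_le n \<rho> \<sigma> in auto)
    finally have 1: "norm Y1 \<le> 2 * (\<rho> * n / 16) * (1 / 11)" using Y(4) by linarith
    have 2: "sqrt k * l \<le> \<rho> * n / 16"
      using Sl mult_right_mono[OF S(2), of l] l0 by linarith
    have "16 / 9 * n\<^sup>2 / \<sigma> = 16 / 9 * (n * (n / \<sigma>))" by (simp add: power2_eq_square)
    also have "\<dots> \<le> 16 / 9 * (n * (\<rho> / 11))"
      using n_div n by (intro mult_left_mono) auto
    finally have 3: "16 / 9 * n\<^sup>2 / \<sigma> \<le> 16 / 9 * (n * (\<rho> / 11))" .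
    have "0 < \<rho> * n" using \<rho> n by simp
    then show ?thesis using 1 2 3 Y(5) by (simp add: mult.commute[of n \<rho>])
  qed
  then have "\<omega>2 * (norm Y1 + norm Y2) \<le> \<omega>2 * (\<rho> * n / 4)"
    using \<omega> by (intro mult_left_mono) auto
  then have vY: "v \<bullet> (Y1 + Y2) \<le> a / 4"
    using v_le[OF Y(2)] v_le[OF Y(3)] a(1) \<omega> by (simp add: inner_add_right \<rho>_def algebra_simps)
  define U where "U = inv (\<lambda>u. adjoint (dgram X) (dgram X u) + l *\<^sub>R u) (adjoint (dgram X) v)"
  have U: "adjoint (dgram X) (dgram X U) + l *\<^sub>R U = adjoint (dgram X) v"
    unfolding U_def by (rule damped_normal_equation[OF D l0])
  have "a \<le> v \<bullet> \<delta>"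
    using v[unfolded subdifferential_def] by (simp add: a_def \<delta>_def inner_diff_right) (smt (verit))
  then have align: "3 / 4 * a \<le> dgram X U \<bullet> \<delta>"
    using damped_direction_inner[OF D l0 U Y(1)] vY by simp
  have "norm (gram U) \<le> \<pi>\<^sup>2 / (4 * l)"
    using norm_gram_le[of U] damped_direction_bounds(2)[OF D l0 U] by (simp add: \<pi>_def)
  from polyak_descent[of \<delta> a g C l t \<pi> "dgram X U" "gram U", OF _ a(2) g(1) _ _ _ _ _ this align]
  have descent: "(norm (\<delta> - t *\<^sub>R dgram X U + t\<^sup>2 *\<^sub>R gram U))\<^sup>2 \<le> n\<^sup>2 - g * a\<^sup>2 / \<pi>\<^sup>2 / 8"
    using n g l t damped_direction_bounds(1)[OF D l0 U] by (simp add: n_def \<delta>_def a_def \<pi>_def)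
  have "gram (lmm_step gram t l X v) = gram (X + (- t) *\<^sub>R U)"
    by (simp add: lmm_step_def frechet_derivative_gram Let_def U_def)
  also have "\<dots> - Zs = \<delta> - t *\<^sub>R dgram X U + t\<^sup>2 *\<^sub>R gram U"
    unfolding gram_add gram_scaleR linear_scale[OF D] by (simp add: \<delta>_def)
  finally have step: "(norm (gram (lmm_step gram t l X v) - Zs))\<^sup>2 \<le> n\<^sup>2 - g * a\<^sup>2 / \<pi>\<^sup>2 / 8"
    using descent by simp
  have \<pi>0: "0 < \<pi>"
    using align a(2) damped_direction_bounds(1)[OF D l0 U] norm_cauchy_schwarz[of "dgram X U" \<delta>]
    by (cases "\<pi> = 0") (auto simp: \<pi>_def)
  have "\<pi> \<le> \<omega>2"
  proof -
    let ?p = "orth_proj (range (dgram X)) v"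
    have sub: "subspace (range (dgram X))" by (intro linear_subspace_image D subspace_UNIV)
    have p: "?p \<in> range (dgram X)" by (rule orth_proj_in[OF sub])
    then have "rank (mat_of ?p) \<le> 2 * CARD('r)" using rank_dgram_le by auto
    from v_le[OF this] have "\<pi> * \<pi> \<le> \<omega>2 * \<pi>"
      using orth_proj_inner[OF sub p, of v] by (simp add: \<pi>_def flip: power2_eq_square power2_norm_eq_inner)
    then show ?thesis using \<pi>0 by simp
  qed
  then have "(\<omega>0 * n)\<^sup>2 / \<omega>2\<^sup>2 \<le> a\<^sup>2 / \<pi>\<^sup>2"
    using a \<pi>0 \<omega> n by (intro frac_le power_mono) auto
  then have "g / 8 * ((\<omega>0 * n)\<^sup>2 / \<omega>2\<^sup>2) \<le> g / 8 * (a\<^sup>2 / \<pi>\<^sup>2)"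
    using g by (intro mult_left_mono) auto
  moreover have "g / 8 * (a\<^sup>2 / \<pi>\<^sup>2) = g * a\<^sup>2 / \<pi>\<^sup>2 / 8" by simp
  moreover have "(1 - g / 8 * (\<omega>0\<^sup>2 / \<omega>2\<^sup>2)) * n\<^sup>2 = n\<^sup>2 - g / 8 * ((\<omega>0 * n)\<^sup>2 / \<omega>2\<^sup>2)"
    by (simp add: power_mult_distrib left_diff_distrib)
  ultimately have "n\<^sup>2 - g * a\<^sup>2 / \<pi>\<^sup>2 / 8 \<le> (1 - g / 8 * (\<omega>0\<^sup>2 / \<omega>2\<^sup>2)) * n\<^sup>2"
    by linarith
  then show ?thesis using step by (simp add: n_def \<delta>_def)
qed

section \<open>Linear convergence for sharp losses\<close>

lemma sharp_unique_minimizer: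
  fixes h :: "'y::real_normed_vector \<Rightarrow> real" and F :: "'e \<Rightarrow> 'y"
  assumes z: "z \<in> range F" and c: "0 < c"
    and sharp: "\<And>w. w \<in> range F \<Longrightarrow> c * norm (w - z) \<le> h w - h z"
  shows "min_value h F = h z" and "minimizers h F = {z}"
proof -
  have le: "h z \<le> h w" if "w \<in> range F" for w
    using sharp[OF that] c by (smt (verit) mult_nonneg_nonneg norm_ge_zero)
  then show "min_value h F = h z"
    unfolding min_value_def using z by (intro cInf_eq_minimum) auto
  have "w = z" if "w \<in> range F" "\<not> h z < h w" for w
  proof (rule ccontr)
    assume "w \<noteq> z"
    then have "0 < c * norm (w - z)" using c by simp
    then show False using sharp[OF that(1)] that(2) by simp
  qed
  then show "minimizers h F = {z}"
    unfolding minimizers_def is_arg_min_def using z le by (auto simp: not_less)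
qed

text \<open>
  Each step contracts, in particular it keeps the iterate in the region where the next step contracts. An
  iterate at the solution has stepsize zero and stays there.
\<close>

theorem lmm_polyak_linear_convergence:
  fixes X :: "nat \<Rightarrow> real^'r::finite^'d::finite" and Zs :: "'d symmat" and h :: "'d symmat \<Rightarrow> real"
  assumes psd: "psd Zs" and rs: "rank (mat_of Zs) = rs" "1 \<le> rs" "rs \<le> CARD('r)"
    and \<omega>: "0 < \<omega>0" "\<omega>0 \<le> \<omega>2"
    and subgrad_le: "\<And>k W. rank (mat_of W) \<le> 2 * CARD('r) \<Longrightarrow> V k \<bullet> W \<le> \<omega>2 * norm W"
    and sharp: "\<And>Z. rank (mat_of Z) \<le> CARD('r) \<Longrightarrow> \<omega>0 * norm (Z - Zs) \<le> h Z - h Zs"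
    and run: "lmm_run h gram \<gamma> lam X V"
    and config: "polyak_config h gram g Clb Cub \<gamma> lam X V"
    and g: "g \<le> min 1 (Clb / 2)"
    and Cub: "Cub \<le> 1 / (16 * sqrt (2 * (real CARD('r) - real rs + 1))) * (\<omega>0\<^sup>2 / \<omega>2\<^sup>2)"
    and init: "norm (gram (X 0) - Zs) \<le> 1 / (8 * sqrt 2) * (\<omega>0 / \<omega>2) * eigval rs Zs"
  shows "(norm (gram (X k) - Zs))\<^sup>2
           \<le> (1 - g / 8 * (\<omega>0\<^sup>2 / \<omega>2\<^sup>2)) ^ k * (norm (gram (X 0) - Zs))\<^sup>2"
proof -
  define c where "c = 1 - g / 8 * (\<omega>0\<^sup>2 / \<omega>2\<^sup>2)"
  have Zs: "Zs \<in> range (gram :: real^'r^'d \<Rightarrow> _)"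
    using psd_in_range_gram[OF psd] rs by simp
  have min: "min_value h (gram :: real^'r^'d \<Rightarrow> _) = h Zs"
    "minimizers h (gram :: real^'r^'d \<Rightarrow> _) = {Zs}"
    using sharp_unique_minimizer[OF Zs \<omega>(1)] sharp rank_gram_le by blast+
  have g0: "0 < g" and Clb: "0 < Clb" using config by (simp_all add: polyak_config_def)
  have \<gamma>: "\<gamma> k = g * ((h (gram (X k)) - h Zs) / (norm (orth_proj (range (dgram (X k))) (V k)))\<^sup>2)"
    and lam: "Clb * norm (gram (X k) - Zs) \<le> lam k" "lam k \<le> Cub * norm (gram (X k) - Zs)" for k
    using config
    unfolding polyak_config_def min frechet_derivative_gram infdist_singleton dist_norm by auto
  have step: "(norm (gram (X (Suc k)) - Zs))\<^sup>2 \<le> c * (norm (gram (X k) - Zs))\<^sup>2"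
    if close: "norm (gram (X k) - Zs) \<le> 1 / (8 * sqrt 2) * (\<omega>0 / \<omega>2) * eigval rs Zs" for k
  proof (cases "gram (X k) = Zs")
    case True
    then have "X (Suc k) = X k"
      using run \<gamma>[of k] by (simp add: lmm_run_def lmm_step_def Let_def)
    with True show ?thesis by simp
  next
    case False
    have V: "V k \<in> subdifferential h (gram (X k))" and next_X:
      "X (Suc k) = lmm_step gram (\<gamma> k) (lam k) (X k) (V k)"
      using run by (simp_all add: lmm_run_def)
    show ?thesis
      unfolding next_X c_def
      by (rule lmm_step_contraction[OF psd rs \<omega> V subgrad_le sharp[OF rank_gram_le] close
            False g0 g Clb Cub lam \<gamma>])
  qed
  have "g / 8 * (\<omega>0\<^sup>2 / \<omega>2\<^sup>2) \<le> 1 * 1"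
    using g g0 \<omega> by (intro mult_mono) (auto simp: divide_le_eq power_mono)
  then have c: "0 \<le> c" "c \<le> 1" using g0 \<omega> by (simp_all add: c_def)
  show ?thesis
    unfolding c_def[symmetric]
  proof (induction k)
    case (Suc k)
    have "c ^ k * (norm (gram (X 0) - Zs))\<^sup>2 \<le> (norm (gram (X 0) - Zs))\<^sup>2"
      using c by (intro mult_left_le_one_le) (auto simp: power_le_one)
    with Suc have "(norm (gram (X k) - Zs))\<^sup>2 \<le> (norm (gram (X 0) - Zs))\<^sup>2" by linarith
    then have "norm (gram (X k) - Zs) \<le> norm (gram (X 0) - Zs)"
      by (rule power2_le_imp_le) simp
    with init have "norm (gram (X k) - Zs) \<le> 1 / (8 * sqrt 2) * (\<omega>0 / \<omega>2) * eigval rs Zs"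
      by linarith
    from step[OF this] have "(norm (gram (X (Suc k)) - Zs))\<^sup>2 \<le> c * (norm (gram (X k) - Zs))\<^sup>2" .
    also have "\<dots> \<le> c * (c ^ k * (norm (gram (X 0) - Zs))\<^sup>2)"
      using Suc c by (intro mult_left_mono) auto
    finally show ?case by (simp add: mult_ac)
  qed simp
qed

section \<open>The l1 loss with outliers\<close>

lemma l1norm_eq_split: "l1norm y = l1norm_on (- J) y + l1norm_on J y"
  unfolding l1norm_on_def using sum.subset_diff[of J UNIV "\<lambda>i. \<bar>y $ i\<bar>"]
  by (simp add: Compl_eq_Diff_UNIV)

lemma l1_loss_increment_le:
  assumes "linear \<A>"
  shows "l1_loss \<A> b (Z + W) - l1_loss \<A> b Z \<le> l1norm (\<A> W)"
proof -
  have "l1_loss \<A> b (Z + W) \<le> (\<Sum>i\<in>UNIV. \<bar>(\<A> Z - b) $ i\<bar> + \<bar>\<A> W $ i\<bar>)"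
    unfolding l1_loss_def l1norm_on_def by (intro sum_mono) (simp add: linear_add[OF assms])
  then show ?thesis by (simp add: l1_loss_def l1norm_on_def sum.distrib)
qed

lemma subgradient_l1_loss_le:
  assumes "linear \<A>" and "v \<in> subdifferential (l1_loss \<A> b) Z"
  shows "v \<bullet> W \<le> l1norm (\<A> W)"
proof -
  have "l1_loss \<A> b (Z + W) \<ge> l1_loss \<A> b Z + v \<bullet> (Z + W - Z)"
    using assms(2) unfolding subdifferential_def by blast
  then show ?thesis using l1_loss_increment_le[OF assms(1), of b Z W] by simp
qed

text \<open>
  Moving from \<open>Zs\<close> to \<open>Z\<close> raises the residual on the clean measurements by its full size, since it starts
  at zero, and lowers it on the outliers by at most the change of the measurements there.
\<close>

lemma l1_loss_growth_with_outliers: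
  assumes A: "linear \<A>" and b: "\<And>i. i \<notin> I \<Longrightarrow> b $ i = \<A> Zs $ i"
  shows "l1norm_on (- I) (\<A> (Z - Zs)) - l1norm_on I (\<A> (Z - Zs)) \<le> l1_loss \<A> b Z - l1_loss \<A> b Zs"
proof -
  have AZ: "\<A> (Z - Zs) $ i = \<A> Z $ i - \<A> Zs $ i" for i by (simp add: linear_diff[OF A])
  have "l1norm_on (- I) (\<A> Z - b) = l1norm_on (- I) (\<A> (Z - Zs))" "l1norm_on (- I) (\<A> Zs - b) = 0"
    using b by (auto simp: l1norm_on_def AZ intro!: sum.cong)
  moreover have "l1norm_on I (\<A> Zs - b) \<le> l1norm_on I (\<A> Z - b) + l1norm_on I (\<A> (Z - Zs))"
    unfolding l1norm_on_def sum.distrib[symmetric] by (intro sum_mono) (simp add: AZ)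
  ultimately show ?thesis
    unfolding l1_loss_def l1norm_eq_split[of _ I] by simp
qed

theorem corollary5p14:
  fixes \<A> :: "'d::finite symmat \<Rightarrow> real^'m::finite"
    and Zstar :: "'d symmat"
    and I :: "'m set"
    and \<eta> :: "'m \<Rightarrow> real"
    and b :: "real^'m"
    and rstar :: nat
    and \<omega>0 \<omega>1 \<omega>2 g Clb Cub :: real
    and \<gamma> lam :: "nat \<Rightarrow> real"
    and X :: "nat \<Rightarrow> real^'r::finite^'d"
    and V :: "nat \<Rightarrow> 'd symmat"
  assumes "psd Zstar"
    and "rank (mat_of Zstar) = rstar"
    and "1 \<le> rstar" and "rstar \<le> CARD('r)"
    and "linear \<A>"
    and "0 < \<omega>0" and "0 < \<omega>1" and "0 < \<omega>2"
    and "\<And>Z. rank (mat_of Z) \<le> 2 * CARD('r) \<Longrightarrow>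
          \<omega>1 * norm Z \<le> l1norm (\<A> Z) \<and> l1norm (\<A> Z) \<le> \<omega>2 * norm Z"
    and "\<And>Z. rank (mat_of Z) \<le> 2 * CARD('r) \<Longrightarrow>
          \<omega>0 * norm Z \<le> l1norm_on (- I) (\<A> Z) - l1norm_on I (\<A> Z)"
    and "b = (\<chi> i. if i \<in> I then \<eta> i else \<A> Zstar $ i)"
    and "lmm_run (l1_loss \<A> b) gram \<gamma> lam X V"
    and "polyak_config (l1_loss \<A> b) gram g Clb Cub \<gamma> lam X V"
    and "g \<le> min 1 (Clb / 2)"
    and "Cub \<le> 1 / (16 * sqrt (2 * (real CARD('r) - real rstar + 1))) * (\<omega>0\<^sup>2 / \<omega>2\<^sup>2)"
    and "norm (gram (X 0) - Zstar) \<le> 1 / (8 * sqrt 2) * (\<omega>0 / \<omega>2) * eigval rstar Zstar"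
  shows "\<forall>k. (norm (gram (X k) - Zstar))\<^sup>2
           \<le> (1 - g / 8 * (\<omega>0\<^sup>2 / \<omega>2\<^sup>2)) ^ k * (norm (gram (X 0) - Zstar))\<^sup>2"
proof -
  note A = \<open>linear \<A>\<close>
  note bounds = assms(9) and mixed = assms(10)
  have "\<omega>0 \<le> \<omega>2"
  proof -
    have rank: "rank (mat_of Zstar) \<le> 2 * CARD('r)" using assms(2,4) by simp
    have "l1norm_on (- I) (\<A> Zstar) - l1norm_on I (\<A> Zstar) \<le> l1norm (\<A> Zstar)"
      unfolding l1norm_eq_split[of _ I] by (simp add: l1norm_on_def sum_nonneg)
    then have "\<omega>0 * norm Zstar \<le> \<omega>2 * norm Zstar"
      using bounds[OF rank] mixed[OF rank] by linarith
    moreover have "Zstar \<noteq> 0" using assms(2,3) by auto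
    ultimately show ?thesis by simp
  qed
  have sharp: "\<omega>0 * norm (Z - Zstar) \<le> l1_loss \<A> b Z - l1_loss \<A> b Zstar"
    if "rank (mat_of Z) \<le> CARD('r)" for Z
  proof -
    have "rank (mat_of (Z - Zstar)) \<le> 2 * CARD('r)"
      using rank_symmat_diff_le[of Z Zstar] that assms(2,4) by linarith
    from mixed[OF this] show ?thesis
      using l1_loss_growth_with_outliers[OF A, of I b Zstar Z] assms(11) by force
  qed
  have "V k \<bullet> W \<le> \<omega>2 * norm W" if "rank (mat_of W) \<le> 2 * CARD('r)" for k W
    using subgradient_l1_loss_le[OF A, of "V k"] bounds[OF that] assms(12)
    unfolding lmm_run_def by (meson order_trans)
  from lmm_polyak_linear_convergence[OF assms(1-4) \<open>0 < \<omega>0\<close> \<open>\<omega>0 \<le> \<omega>2\<close> this sharp assms(12-16)]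
  show ?thesis by blast
qed

end
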